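(* Let $X^t$ be a flow without fixed points on a compact metric space $M$ and let $N>0$ be an integer. Then $X^t$ is $N$-expansive if, and only if, given a $\delta$-adequate pair $(\mathcal{S},\mathcal{T})$ of families of cross-sections, $\mathcal{S}=\{S_1,\dots,S_k\}$, $\mathcal{T}=\{T_1,\dots,T_k\}$, there is $\eta>0$ such that $$\#\bigl(W^s_\eta(x)\cap W^u_\eta(x)\bigr)\leq N\qquad\text{for all } x\in\bigcup_{i=1}^k T_i .$$
   Context: Flows. A flow on a compact metric space $M$ (metric $d$) is a family $X^t=\{X^t\}_{t\in\mathbb{R}}$ of homeomorphisms of $M$ with $X^0(x)=x$ and $X^{t+s}(x)=X^t(X^s(x))$ for all $x\in M$, $s,t\in\mathbb{R}$; flows are taken to be continuous. A point $x$ is fixed if $X^t(x)=x$ for all $t$. For $I\subset\mathbb{R}$ and $B\subset M$, $X^{I}(B)=\{X^t(b): t\in I,\ b\in B\}$, and $X^I(x)=X^I(\{x\})$. $N$-expansivity. Let $\mathrm{Hom}_0(\mathbb{R})$ be the set of homeomorphisms of $\mathbb{R}$ fixing $0$. For $A\subset M$, $\mathcal{H}(A)$ is the set of maps $\alpha:A\to \mathrm{Hom}_0(\mathbb{R})$ such that there is a point $x_\alpha\in A$ with $\alpha(x_\alpha)=\mathrm{id}_{\mathbb{R}}$, and such that for each $t\in\mathbb{R}$ the map $x\mapsto\alpha(x)(t)$ is continuous on $A$. Put $\mathcal{X}^t_\alpha(A)=\{X^{\alpha(x)(t)}(x): x\in A\}$. The flow is $N$-expansive if for every $\epsilon'>0$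 there is $\delta'>0$ such that whenever $A\subset M$ and $\alpha\in\mathcal{H}(A)$ satisfy $\operatorname{diam}(\mathcal{X}^t_\alpha(A))<\delta'$ for all $t\in\mathbb{R}$, there is $B\subset A$ of cardinality less than $N+1$ with $A\subset X^{(-\epsilon',\epsilon')}(B)$. Cross-sections. A set $S\subset M$ is a (local) cross-section of time $\epsilon>0$ if it is closed and $S\cap X^{(-\epsilon,\epsilon)}(x)=\{x\}$ for each $x\in S$. Its interior is $S^*=\operatorname{int}(X^{(-\epsilon,\epsilon)}(S))\cap S$. Adequate pairs. It is known that, since $X^t$ is continuous and has no fixed points, there is $\epsilon>0$ such that for each $\delta>0$ there is a pair $(\mathcal{S},\mathcal{T})$ of finite families $\mathcal{S}=\{S_1,\dots,S_k\}$, $\mathcal{T}=\{T_1,\dots,T_k\}$ of local cross-sections of time $\epsilon$ and diameter at most $\delta$, with $T_i\subset S_i^*$ for each $i\in\{1,\dots,k\}$ and $$M=\bigcup_{i=1}^{k} X^{[0,\epsilon]}(T_i)=\bigcup_{i=1}^{k} X^{[-\epsilon,0]}(T_i)=\bigcup_{i=1}^{k} X^{[0,\epsilon]}(S_i)=\bigcup_{i=1}^{k} X^{[-\epsilon,0]}(S_i).$$ A pair $(\mathcal{S},\mathcal{T})$ with these properties is called $\delta$-adequate. Constants and projections. Given a $\delta$-adequate pair, let $\theta=\sup\{r>0: X^{(0,r)}(x)\cap\bigcup_{i=1}^kS_i=\emptyset \text{ for all } x\in\bigcup_{i=1}^kS_i\}$. Let $\rho>0$ satisfy $5\rho<\epsilon$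 and $2\rho<\theta$. For each $i$ let $D^i_\rho=X^{(-\rho,\rho)}(S_i)$ and let $P^i_\rho:D^i_\rho\to S_i$ be the projection $P^i_\rho(x)=X^t(x)$, where $|t|<\rho$ and $X^t(x)\in S_i$. Let $0<\epsilon_0<\tfrac12\theta$ be such that if $x,y\in S_i$, $d(x,y)<\epsilon_0$, $|t|<3\delta$ and $X^t(x)\in T_j$, then $X^t(y)\in D^j_\rho$. Return map. Let $\phi:\bigcup_{i=1}^k T_i\to\bigcup_{i=1}^k T_i$ be the first return map: $\phi(x)=X^t(x)$, where $t>0$ is the smallest positive number such that $X^t(x)\in\bigcup_{i=1}^k T_i$. Following sequences. For $x\in T_i$ and $y\in S_i$ with $d(x,y)<\epsilon_0$, put $y_0=y$ and $y_j=P^l_\rho(X^t(y_{j-1}))$, where $t>0$ is the smallest positive time such that $\phi^j(x)=X^t(\phi^{j-1}(x))$ and $l$ is such that $\phi^j(x)\in T_l$; the construction is continued while $d(\phi^j(x),y_j)<\epsilon_0$. For $j<0$, $y_j$ is defined similarly. The points $y_j$ depend on $x$. Stable and unstable sets. For $x\in T_i$ and $0<\eta<\epsilon_0$, $$W^s_\eta(x)=\{y\in S_i: d(\phi^j(x),y_j)<\eta\ \ \forall j\ge0\},\qquad W^u_\eta(x)=\{y\in S_i: d(\phi^j(x),y_j)<\eta\ \ \forall j\le0\}.$$ *)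

theory Defs
  imports "HOL-Analysis.Analysis"
begin

text \<open>The compact metric space is a type of class metric_space whose universe is compact;
  a family of maps is written as a function \<open>X :: real \<Rightarrow> 'a \<Rightarrow> 'a\<close>.\<close>

definition is_flow :: "(real \<Rightarrow> 'a::metric_space \<Rightarrow> 'a) \<Rightarrow> bool" where
  "is_flow X \<longleftrightarrow>
     (\<forall>t. \<exists>g. homeomorphism UNIV UNIV (X t) g) \<and>
     (\<forall>x. X 0 x = x) \<and>
     (\<forall>s t x. X (t + s) x = X t (X s x)) \<and>
     continuous_on UNIV (\<lambda>(t, x). X t x)"

definition fixed_point :: "(real \<Rightarrow> 'a \<Rightarrow> 'a) \<Rightarrow> 'a \<Rightarrow> bool" where
  "fixed_point X x \<longleftrightarrow> (\<forall>t. X t x = x)"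

definition flow_image :: "(real \<Rightarrow> 'a \<Rightarrow> 'a) \<Rightarrow> real set \<Rightarrow> 'a set \<Rightarrow> 'a set" where
  "flow_image X I B = {X t b | t b. t \<in> I \<and> b \<in> B}"

text \<open>Orientation-reversing homeomorphisms are not excluded.\<close>

definition Hom0 :: "(real \<Rightarrow> real) set" where
  "Hom0 = {h. (\<exists>g. homeomorphism UNIV UNIV h g) \<and> h 0 = 0}"

definition reparams :: "'a::metric_space set \<Rightarrow> ('a \<Rightarrow> real \<Rightarrow> real) set" where
  "reparams A =
     {\<alpha>. (\<forall>x\<in>A. \<alpha> x \<in> Hom0) \<and>
         (\<exists>x\<in>A. \<alpha> x = id) \<and>
         (\<forall>t. continuous_on A (\<lambda>x. \<alpha> x t))}"

definition reparam_image ::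
  "(real \<Rightarrow> 'a \<Rightarrow> 'a) \<Rightarrow> ('a \<Rightarrow> real \<Rightarrow> real) \<Rightarrow> real \<Rightarrow> 'a set \<Rightarrow> 'a set" where
  "reparam_image X \<alpha> t A = {X (\<alpha> x t) x | x. x \<in> A}"

definition N_expansive :: "(real \<Rightarrow> 'a::metric_space \<Rightarrow> 'a) \<Rightarrow> nat \<Rightarrow> bool" where
  "N_expansive X N \<longleftrightarrow>
     (\<forall>e>0. \<exists>d>0. \<forall>A. \<forall>\<alpha>\<in>reparams A.
        (\<forall>t. diameter (reparam_image X \<alpha> t A) < d) \<longrightarrow>
        (\<exists>B\<subseteq>A. finite B \<and> card B < N + 1 \<and> A \<subseteq> flow_image X {-e<..<e} B))"

definition cross_section ::
  "(real \<Rightarrow> 'a::metric_space \<Rightarrow> 'a) \<Rightarrow> real \<Rightarrow> 'a set \<Rightarrow> bool" where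
  "cross_section X \<epsilon> S \<longleftrightarrow>
     closed S \<and> (\<forall>x\<in>S. S \<inter> flow_image X {-\<epsilon><..<\<epsilon>} {x} = {x})"

definition section_interior ::
  "(real \<Rightarrow> 'a::metric_space \<Rightarrow> 'a) \<Rightarrow> real \<Rightarrow> 'a set \<Rightarrow> 'a set" where
  "section_interior X \<epsilon> S = interior (flow_image X {-\<epsilon><..<\<epsilon>} S) \<inter> S"

text \<open>A family of \<open>k\<close> sections is a function on \<open>nat\<close> of which only the values at
  \<open>1, \<dots>, k\<close> matter.\<close>

definition adequate_pair ::
  "(real \<Rightarrow> 'a::metric_space \<Rightarrow> 'a) \<Rightarrow> real \<Rightarrow> real \<Rightarrow> nat \<Rightarrow> (nat \<Rightarrow> 'a set) \<Rightarrow> (nat \<Rightarrow> 'a set) \<Rightarrow> bool"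
  where
  "adequate_pair X \<epsilon> \<delta> k S T \<longleftrightarrow>
     (\<forall>i\<in>{1..k}. cross_section X \<epsilon> (S i) \<and> diameter (S i) \<le> \<delta> \<and>
                 cross_section X \<epsilon> (T i) \<and> diameter (T i) \<le> \<delta> \<and>
                 T i \<subseteq> section_interior X \<epsilon> (S i)) \<and>
     (\<Union>i\<in>{1..k}. flow_image X {0..\<epsilon>} (T i)) = UNIV \<and>
     (\<Union>i\<in>{1..k}. flow_image X {-\<epsilon>..0} (T i)) = UNIV \<and>
     (\<Union>i\<in>{1..k}. flow_image X {0..\<epsilon>} (S i)) = UNIV \<and>
     (\<Union>i\<in>{1..k}. flow_image X {-\<epsilon>..0} (S i)) = UNIV"

text \<open>Sections need not be disjoint, so the set of admissible \<open>r\<close> may be empty. Inserting \<open>0\<close>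
  makes the supremum \<open>0\<close> then (\<open>Sup {}\<close> on the reals is unspecified) and changes nothing
  otherwise.\<close>

definition theta :: "(real \<Rightarrow> 'a \<Rightarrow> 'a) \<Rightarrow> nat \<Rightarrow> (nat \<Rightarrow> 'a set) \<Rightarrow> real" where
  "theta X k S =
     Sup (insert 0 {r. r > 0 \<and>
       (\<forall>x\<in>(\<Union>i\<in>{1..k}. S i). flow_image X {0<..<r} {x} \<inter> (\<Union>i\<in>{1..k}. S i) = {})})"

definition rho_ok :: "(real \<Rightarrow> 'a \<Rightarrow> 'a) \<Rightarrow> real \<Rightarrow> nat \<Rightarrow> (nat \<Rightarrow> 'a set) \<Rightarrow> real \<Rightarrow> bool" where
  "rho_ok X \<epsilon> k S \<rho> \<longleftrightarrow> 0 < \<rho> \<and> 5 * \<rho> < \<epsilon> \<and> 2 * \<rho> < theta X k S"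

definition Dset :: "(real \<Rightarrow> 'a \<Rightarrow> 'a) \<Rightarrow> real \<Rightarrow> 'a set \<Rightarrow> 'a set" where
  "Dset X \<rho> S = flow_image X {-\<rho><..<\<rho>} S"

text \<open>Meaningful only for arguments in \<open>Dset X \<rho> S\<close>.\<close>

definition proj :: "(real \<Rightarrow> 'a \<Rightarrow> 'a) \<Rightarrow> real \<Rightarrow> 'a set \<Rightarrow> 'a \<Rightarrow> 'a" where
  "proj X \<rho> S x = (THE w. w \<in> S \<and> (\<exists>t. \<bar>t\<bar> < \<rho> \<and> w = X t x))"

definition eps0_ok ::
  "(real \<Rightarrow> 'a::metric_space \<Rightarrow> 'a) \<Rightarrow> real \<Rightarrow> nat \<Rightarrow> (nat \<Rightarrow> 'a set) \<Rightarrow> (nat \<Rightarrow> 'a set) \<Rightarrow>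
     real \<Rightarrow> real \<Rightarrow> bool" where
  "eps0_ok X \<delta> k S T \<rho> \<epsilon>0 \<longleftrightarrow>
     0 < \<epsilon>0 \<and> \<epsilon>0 < theta X k S / 2 \<and>
     (\<forall>i\<in>{1..k}. \<forall>j\<in>{1..k}. \<forall>x\<in>S i. \<forall>y\<in>S i. \<forall>t.
        dist x y < \<epsilon>0 \<and> \<bar>t\<bar> < 3 * \<delta> \<and> X t x \<in> T j \<longrightarrow> X t y \<in> Dset X \<rho> (S j))"

definition return_map :: "(real \<Rightarrow> 'a \<Rightarrow> 'a) \<Rightarrow> nat \<Rightarrow> (nat \<Rightarrow> 'a set) \<Rightarrow> 'a \<Rightarrow> 'a" where
  "return_map X k T x = X (LEAST t. 0 < t \<and> X t x \<in> (\<Union>i\<in>{1..k}. T i)) x"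

definition return_iter ::
  "(real \<Rightarrow> 'a \<Rightarrow> 'a) \<Rightarrow> nat \<Rightarrow> (nat \<Rightarrow> 'a set) \<Rightarrow> int \<Rightarrow> 'a \<Rightarrow> 'a" where
  "return_iter X k T j =
     (if 0 \<le> j then return_map X k T ^^ nat j
      else inv_into (\<Union>i\<in>{1..k}. T i) (return_map X k T) ^^ nat (- j))"

definition hit_time :: "(real \<Rightarrow> 'a \<Rightarrow> 'a) \<Rightarrow> 'a \<Rightarrow> 'a \<Rightarrow> real" where
  "hit_time X a b = (LEAST t. 0 < t \<and> b = X t a)"

text \<open>\<open>following X k S T \<rho> \<epsilon>0 x y j z\<close> says that the construction starting from \<open>y\<close> reaches index
  \<open>j\<close> and that \<open>y\<^sub>j = z\<close>. It stops where the distance is at least \<open>\<epsilon>0\<close>, and also where the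
  projection is undefined. Since \<open>2\<rho> < \<theta>\<close>, different admissible choices of \<open>l\<close> give the same
  point.\<close>

inductive following ::
  "(real \<Rightarrow> 'a::metric_space \<Rightarrow> 'a) \<Rightarrow> nat \<Rightarrow> (nat \<Rightarrow> 'a set) \<Rightarrow> (nat \<Rightarrow> 'a set) \<Rightarrow> real \<Rightarrow> real \<Rightarrow>
     'a \<Rightarrow> 'a \<Rightarrow> int \<Rightarrow> 'a \<Rightarrow> bool"
  for X k S T \<rho> \<epsilon>0 x y where
  start: "dist x y < \<epsilon>0 \<Longrightarrow> following X k S T \<rho> \<epsilon>0 x y 0 y"
| forward:
    "\<lbrakk> following X k S T \<rho> \<epsilon>0 x y j z; 0 \<le> j; dist (return_iter X k T j x) z < \<epsilon>0;
       l \<in> {1..k}; return_iter X k T (j + 1) x \<in> T l;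
       w = X (hit_time X (return_iter X k T j x) (return_iter X k T (j + 1) x)) z;
       w \<in> Dset X \<rho> (S l) \<rbrakk>
     \<Longrightarrow> following X k S T \<rho> \<epsilon>0 x y (j + 1) (proj X \<rho> (S l) w)"
| backward:
    "\<lbrakk> following X k S T \<rho> \<epsilon>0 x y j z; j \<le> 0; dist (return_iter X k T j x) z < \<epsilon>0;
       l \<in> {1..k}; return_iter X k T (j - 1) x \<in> T l;
       w = X (- hit_time X (return_iter X k T (j - 1) x) (return_iter X k T j x)) z;
       w \<in> Dset X \<rho> (S l) \<rbrakk>
     \<Longrightarrow> following X k S T \<rho> \<epsilon>0 x y (j - 1) (proj X \<rho> (S l) w)"

text \<open>The index \<open>i\<close> is the one with \<open>x \<in> T i\<close>; it is an argument because the sections may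
  overlap.\<close>

definition stable_set ::
  "(real \<Rightarrow> 'a::metric_space \<Rightarrow> 'a) \<Rightarrow> nat \<Rightarrow> (nat \<Rightarrow> 'a set) \<Rightarrow> (nat \<Rightarrow> 'a set) \<Rightarrow> real \<Rightarrow> real \<Rightarrow>
     real \<Rightarrow> nat \<Rightarrow> 'a \<Rightarrow> 'a set" where
  "stable_set X k S T \<rho> \<epsilon>0 \<eta> i x =
     {y \<in> S i. \<forall>j\<ge>0. \<exists>z. following X k S T \<rho> \<epsilon>0 x y j z \<and> dist (return_iter X k T j x) z < \<eta>}"

definition unstable_set ::
  "(real \<Rightarrow> 'a::metric_space \<Rightarrow> 'a) \<Rightarrow> nat \<Rightarrow> (nat \<Rightarrow> 'a set) \<Rightarrow> (nat \<Rightarrow> 'a set) \<Rightarrow> real \<Rightarrow> real \<Rightarrow>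
     real \<Rightarrow> nat \<Rightarrow> 'a \<Rightarrow> 'a set" where
  "unstable_set X k S T \<rho> \<epsilon>0 \<eta> i x =
     {y \<in> S i. \<forall>j\<le>0. \<exists>z. following X k S T \<rho> \<epsilon>0 x y j z \<and> dist (return_iter X k T j x) z < \<eta>}"

end

theory Submission
  imports Defs
begin

text \<open>
  If \<open>y\<close> lies in the local stable and unstable sets of \<open>x\<close>, its following sequence visits the
  sections after times that differ from the return times of \<open>x\<close> by little, since no orbit has a
  period below \<open>\<theta>\<close>. Interpolating linearly between the two sequences of times reparametrises
  the orbit of \<open>y\<close> so that it shadows that of \<open>x\<close>. Thus \<open>N + 1\<close> points of the intersection,
  \<open>x\<close> among them, would contradict \<open>N\<close>-expansivity. Conversely, a set of mutually shadowing
  orbits is projected along the flow to one intersection of a local stable and a local unstable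
  set, and points with the same projection lie on a short orbit segment. This direction needs one
  adequate pair with \<open>\<theta> > 0\<close>: it is assembled from finitely many disjoint pieces of level sets
  of Whitney's functions.
\<close>

section \<open>Compact flows\<close>

text \<open>Both directions turn on \<open>small_shift\<close>: orbit pieces that are close at both
  ends have nearly equal lengths, provided the difference in length is known beforehand to be below
  every period. For following sequences the projections supply this prior bound, namely
  \<open>\<rho>\<close>. For an arbitrary reparametrisation nothing does, and continuity in time has
  to confine the lag.

  The obstacle in the converse is the time scale of projections. Membership in
  \<open>section_interior\<close> provides hits of \<open>S i\<close> near \<open>T i\<close> within
  time \<open>\<epsilon>\<close>, while the argument has to project in arbitrarily little time. The
  constructed pair therefore satisfies
  \<open>T i \<subseteq> interior (Dset X \<kappa> (S i))\<close> for every positive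
  \<open>\<kappa>\<close>; level sets have this property because a function strictly increasing
  along orbits reaches nearby levels in little time. Since \<open>\<rho>\<close> must satisfy
  \<open>0 < 2 * \<rho> < \<theta>\<close>, the right-hand side would be vacuous if every pair had
  \<open>\<theta> = 0\<close>.\<close>

locale compact_flow =
  fixes X :: "real \<Rightarrow> 'a::metric_space \<Rightarrow> 'a"
  assumes compact_UNIV: "compact (UNIV :: 'a set)"
    and flow: "is_flow X"
begin

lemma flow_0 [simp]: "X 0 x = x"
  using flow unfolding is_flow_def by blast

lemma flow_flow: "X t (X s x) = X (t + s) x"
  using flow unfolding is_flow_def by metis

lemma flow_inverse [simp]: "X (- t) (X t x) = x" "X t (X (- t) x) = x"
  by (simp_all add: flow_flow)

lemma continuous_on_flow_pair: "continuous_on UNIV (\<lambda>(t, x). X t x)"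
  using flow unfolding is_flow_def by blast

lemma continuous_on_flow [continuous_intros]:
  assumes "continuous_on A f" "continuous_on A g"
  shows "continuous_on A (\<lambda>u. X (f u) (g u))"
proof -
  have "continuous_on A (\<lambda>u. (f u, g u))"
    using assms by (intro continuous_intros)
  from continuous_on_compose2[OF continuous_on_flow_pair this] show ?thesis by simp
qed

lemma bounded_all [simp]: "bounded (A :: 'a set)"
  by (meson bounded_subset compact_UNIV compact_imp_bounded subset_UNIV)

lemma compact_closed [simp]: "closed A \<Longrightarrow> compact (A :: 'a set)"
  by (metis compact_Int_closed compact_UNIV inf_top_left)

lemma uniform_flow:
  assumes "0 < e"
  obtains d where "0 < d"
    "\<And>s t x y. \<bar>s\<bar> \<le> R \<Longrightarrow> \<bar>t\<bar> \<le> R \<Longrightarrow> \<bar>s - t\<bar> < d \<Longrightarrow> dist x y < d \<Longrightarrow> dist (X s x) (X t y) < e"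
proof -
  have "compact ({-R..R} \<times> (UNIV :: 'a set))"
    by (intro compact_Times compact_UNIV) auto
  then have "uniformly_continuous_on ({-R..R} \<times> UNIV) (\<lambda>(t, x). X t x)"
    by (intro compact_uniformly_continuous continuous_on_subset[OF continuous_on_flow_pair]) auto
  then obtain d where d: "d > 0"
    "\<forall>p\<in>{-R..R} \<times> UNIV. \<forall>q\<in>{-R..R} \<times> UNIV. dist q p < d \<longrightarrow>
       dist ((\<lambda>(t, x). X t x) q) ((\<lambda>(t, x). X t x) p) < e"
    unfolding uniformly_continuous_on_def using assms by meson
  \<comment> \<open>The tolerance is halved because the product distance is bounded by the sum of
    the distances in time and space.\<close>
  show ?thesis
  proof (rule that[of "d / 2"])
    fix s t and x y :: 'a assume *: "\<bar>s\<bar> \<le> R" "\<bar>t\<bar> \<le> R" "\<bar>s - t\<bar> < d / 2" "dist x y < d / 2"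
    have "dist (s, x) (t, y) \<le> \<bar>s - t\<bar> + dist x y"
      unfolding dist_Pair_Pair dist_real_def by (rule order_trans[OF sqrt_sum_squares_le_sum_abs]) simp
    also have "\<dots> < d" using * by simp
    finally show "dist (X s x) (X t y) < e"
      using d(2) * by (fastforce simp: abs_le_iff)
  qed (use d in simp)
qed

lemma uniform_flow_id:
  assumes "0 < e"
  obtains d where "0 < d" "\<And>t x. \<bar>t\<bar> < d \<Longrightarrow> dist (X t x) x < e"
proof -
  obtain d where d: "0 < d"
    "\<And>s t x y. \<bar>s\<bar> \<le> 1 \<Longrightarrow> \<bar>t\<bar> \<le> 1 \<Longrightarrow> \<bar>s - t\<bar> < d \<Longrightarrow> dist x y < d \<Longrightarrow> dist (X s x) (X t y) < e"
    using uniform_flow[OF assms] by metis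
  show ?thesis
  proof (rule that[of "min d 1"])
    show "dist (X t x) x < e" if "\<bar>t\<bar> < min d 1" for t x
      using d(2)[of t 0 x x] that d(1) by simp
  qed (use d in simp)
qed

text \<open>A minimum over a compact set of times and points is positive when none of these times is
  a period. Negative times reduce to positive ones: the displacement of \<open>w\<close> under
  \<open>s\<close> is that of \<open>X s w\<close> under \<open>-s\<close>.\<close>

lemma displacement_lower_bound:
  assumes "\<And>s w. 0 < s \<Longrightarrow> s \<le> b \<Longrightarrow> X s w \<noteq> w" and "0 < a"
  obtains m where "0 < m" "\<And>s w. a \<le> \<bar>s\<bar> \<Longrightarrow> \<bar>s\<bar> \<le> b \<Longrightarrow> m \<le> dist (X s w) w"
proof (cases "a \<le> b")
  case True
  let ?C = "{a..b} \<times> (UNIV :: 'a set)"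
  have "compact ?C" by (intro compact_Times compact_UNIV) auto
  moreover have "?C \<noteq> {}" using True by auto
  moreover have "continuous_on ?C (\<lambda>p. dist (X (fst p) (snd p)) (snd p))"
    by (intro continuous_intros)
  ultimately obtain p where p: "p \<in> ?C"
    "\<And>q. q \<in> ?C \<Longrightarrow> dist (X (fst p) (snd p)) (snd p) \<le> dist (X (fst q) (snd q)) (snd q)"
    using continuous_attains_inf by (metis (no_types, lifting))
  have "0 < dist (X (fst p) (snd p)) (snd p)"
    using assms p(1) by (auto simp: mem_Times_iff)
  moreover have "dist (X (fst p) (snd p)) (snd p) \<le> dist (X s w) w"
    if "a \<le> \<bar>s\<bar>" "\<bar>s\<bar> \<le> b" for s w
  proof (cases "0 \<le> s")
    case True
    then show ?thesis using p(2)[of "(s, w)"] that by auto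
  next
    case False
    then show ?thesis using p(2)[of "(-s, X s w)"] that by (auto simp: dist_commute)
  qed
  ultimately show ?thesis by (rule that)
qed (use that[of 1] in auto)

text \<open>Both \<open>X g z\<close> and its image under \<open>X s\<close> are near
  \<open>X g p\<close>, so the lower bound on displacements applies. With \<open>a = b\<close> a
  weak bound on \<open>s\<close> improves to a strict one, the form suited to a continuity
  argument.\<close>

lemma small_shift:
  assumes "\<And>s w. 0 < s \<Longrightarrow> s \<le> b \<Longrightarrow> X s w \<noteq> w" and "0 < a"
  obtains \<eta> where "0 < \<eta>"
    "\<And>p z g s. \<bar>g\<bar> \<le> R \<Longrightarrow> \<bar>s\<bar> \<le> b \<Longrightarrow> dist p z < \<eta> \<Longrightarrow> dist (X g p) (X (g + s) z) < \<eta> \<Longrightarrow> \<bar>s\<bar> < a"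
proof -
  obtain m where m: "0 < m" "\<And>s w. a \<le> \<bar>s\<bar> \<Longrightarrow> \<bar>s\<bar> \<le> b \<Longrightarrow> m \<le> dist (X s w) w"
    using displacement_lower_bound[OF assms] by blast
  obtain d where d: "0 < d" "\<And>s t x y. \<bar>s\<bar> \<le> R \<Longrightarrow> \<bar>t\<bar> \<le> R \<Longrightarrow> \<bar>s - t\<bar> < d \<Longrightarrow> dist x y < d
      \<Longrightarrow> dist (X s x) (X t y) < m / 2"
    using uniform_flow[of "m / 2" R] m(1) by (metis half_gt_zero)
  show ?thesis
  proof (rule that[of "min d (m / 2)"])
    fix p z g s
    assume *: "\<bar>g\<bar> \<le> R" "\<bar>s\<bar> \<le> b" "dist p z < min d (m / 2)"
      "dist (X g p) (X (g + s) z) < min d (m / 2)"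
    have 1: "dist (X g p) (X g z) < m / 2"
      using d * by simp
    have 2: "X (g + s) z = X s (X g z)"
      by (simp add: flow_flow add.commute)
    have "dist (X s (X g z)) (X g z) < m"
      using 1 * dist_triangle2[of "X s (X g z)" "X g z" "X g p"] unfolding 2
      by (simp add: dist_commute)
    then show "\<bar>s\<bar> < a" using m(2)[of s] *(2) by (meson not_le)
  qed (use d m in simp)
qed

lemma DsetI: "X t w \<in> S l \<Longrightarrow> \<bar>t\<bar> < r \<Longrightarrow> w \<in> Dset X r (S l)"
  unfolding Dset_def flow_image_def
  by (auto intro!: exI[of _ "-t"] exI[of _ "X t w"])

lemma DsetE:
  assumes "w \<in> Dset X r (S l)"
  obtains t where "\<bar>t\<bar> < r" "X t w \<in> S l"
proof -
  obtain s b where "s \<in> {-r<..<r}" "b \<in> S l" "w = X s b"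
    using assms unfolding Dset_def flow_image_def by blast
  then show ?thesis using that[of "-s"] by (simp add: abs_less_iff)
qed

end

section \<open>Return times to a system of sections\<close>

lemma int_primitive:
  fixes g :: "int \<Rightarrow> real"
  shows "\<exists>G. G 0 = 0 \<and> (\<forall>j. G (j + 1) = G j + g j)"
proof -
  \<comment> \<open>At most one of the two sums is nonempty, so a single formula covers both
    signs.\<close>
  let ?G = "\<lambda>j. (\<Sum>i\<in>{0..<j}. g i) - (\<Sum>i\<in>{j..<0}. g i)"
  have "?G (j + 1) = ?G j + g j" for j
  proof (cases "0 \<le> j")
    case True
    then have "{0..<j + 1} = insert j {0..<j}" by auto
    then show ?thesis using True by simp
  next
    case False
    then have "{j..<0} = insert j {j + 1..<0}" by auto
    then show ?thesis using False by simp
  qed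
  then show ?thesis by (intro exI[of _ ?G]) auto
qed

lemma int_steps_induct [case_names base up down]:
  fixes P :: "int \<Rightarrow> bool"
  assumes "P 0" "\<And>j. 0 \<le> j \<Longrightarrow> P j \<Longrightarrow> P (j + 1)" "\<And>j. j \<le> 0 \<Longrightarrow> P j \<Longrightarrow> P (j - 1)"
  shows "P j"
  by (rule int_induct[of P 0]) (use assms in auto)

locale section_system = compact_flow X
  for X :: "real \<Rightarrow> 'a::metric_space \<Rightarrow> 'a" +
  fixes \<epsilon> \<delta> :: real and k :: nat and S T :: "nat \<Rightarrow> 'a set" and \<rho> :: real
  assumes eps_pos: "0 < \<epsilon>"
    and adequate: "adequate_pair X \<epsilon> \<delta> k S T"
    and rho: "rho_ok X \<epsilon> k S \<rho>"
begin

abbreviation "\<theta> \<equiv> theta X k S"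
abbreviation "SS \<equiv> \<Union>i\<in>{1..k}. S i"
abbreviation "TT \<equiv> \<Union>i\<in>{1..k}. T i"
abbreviation "\<phi> \<equiv> return_map X k T"
abbreviation "orb \<equiv> return_iter X k T"

lemma rho_pos: "0 < \<rho>" and rho_less: "2 * \<rho> < \<theta>" and theta_pos: "0 < \<theta>"
  using rho unfolding rho_ok_def by auto

lemma T_subset_S: "i \<in> {1..k} \<Longrightarrow> T i \<subseteq> S i"
  using adequate unfolding adequate_pair_def section_interior_def by blast

lemma TT_subset_SS: "TT \<subseteq> SS"
  using T_subset_S by blast

lemma closed_TT: "closed TT"
  using adequate unfolding adequate_pair_def cross_section_def by (intro closed_UN) auto

lemma SS_gap_pos:
  assumes "x \<in> SS" "0 < t" "t < \<theta>"
  shows "X t x \<notin> SS"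
proof
  assume "X t x \<in> SS"
  \<comment> \<open>A number below the supremum lies below a member of the set; this member is not
    the inserted 0, since \<open>0 < t\<close>.\<close>
  obtain r where r: "t < r" "r = 0 \<or> r > 0 \<and>
      (\<forall>x\<in>SS. flow_image X {0<..<r} {x} \<inter> SS = {})"
    using assms(3) unfolding theta_def by (elim less_cSupE) auto
  then have "flow_image X {0<..<r} {x} \<inter> SS = {}"
    using assms by auto
  moreover have "X t x \<in> flow_image X {0<..<r} {x}"
    using r(1) assms(2) by (auto simp: flow_image_def)
  ultimately show False using \<open>X t x \<in> SS\<close> by blast
qed

lemma SS_gap:
  assumes "x \<in> SS" "X t x \<in> SS" "\<bar>t\<bar> < \<theta>"
  shows "t = 0"
  using SS_gap_pos[of x t] SS_gap_pos[of "X t x" "-t"] assms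
  by (metis abs_less_iff flow_inverse(1) linorder_neqE_linordered_idom neg_0_less_iff_less)

text \<open>Forward hits come from the covering over \<open>{-\<epsilon>..0}\<close>, where the
  point of the section lies ahead of \<open>x\<close>.\<close>

lemma hits_forward: obtains s where "0 \<le> s" "s \<le> \<epsilon>" "X s x \<in> TT"
proof -
  have "x \<in> (\<Union>i\<in>{1..k}. flow_image X {-\<epsilon>..0} (T i))"
    using adequate unfolding adequate_pair_def by blast
  then obtain i t b where *: "i \<in> {1..k}" "t \<in> {-\<epsilon>..0}" "b \<in> T i" "x = X t b"
    unfolding flow_image_def by blast
  then have "X (- t) x \<in> TT" by auto
  then show ?thesis using that[of "-t"] * by simp
qed

lemma hits_backward: obtains s where "0 \<le> s" "s \<le> \<epsilon>" "X (- s) x \<in> TT"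
proof -
  have "x \<in> (\<Union>i\<in>{1..k}. flow_image X {0..\<epsilon>} (T i))"
    using adequate unfolding adequate_pair_def by blast
  then obtain i t b where *: "i \<in> {1..k}" "t \<in> {0..\<epsilon>}" "b \<in> T i" "x = X t b"
    unfolding flow_image_def by blast
  then have "X (- t) x \<in> TT" by auto
  then show ?thesis using that[of t] * by simp
qed

text \<open>A period is shared by the whole orbit, and the orbit meets a section, where returns
  before \<open>\<theta>\<close> are excluded.\<close>

lemma no_small_period:
  assumes "0 < s" "s < \<theta>"
  shows "X s w \<noteq> w"
proof
  assume "X s w = w"
  obtain t where "X t w \<in> TT" using hits_forward by blast
  moreover from \<open>X s w = w\<close> have "X s (X t w) = X t w"
    by (metis add.commute flow_flow)
  ultimately show False
    using SS_gap[of "X t w" s] assms TT_subset_SS by auto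
qed

subsection \<open>The first return map\<close>

definition ret_time :: "'a \<Rightarrow> real" where
  "ret_time x = (LEAST t. 0 < t \<and> X t x \<in> TT)"

text \<open>No return happens before \<open>\<theta>\<close>, and one happens within
  \<open>\<epsilon>\<close> after it, so the search takes place in a compact interval. An attained
  minimum is what gives \<open>LEAST\<close> on the reals a meaning.\<close>

lemma ret_time_aux:
  assumes "x \<in> TT"
  obtains m where "\<theta> \<le> m" "m \<le> \<theta> + \<epsilon>" "X m x \<in> TT" "\<And>t. 0 < t \<Longrightarrow> X t x \<in> TT \<Longrightarrow> m \<le> t"
proof -
  let ?R = "{\<theta>..\<theta> + \<epsilon>} \<inter> (\<lambda>t. X t x) -` TT"
  have "continuous_on UNIV (\<lambda>t. X t x)" by (intro continuous_intros)
  then have "closed ((\<lambda>t. X t x) -` TT)"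
    using closed_TT by (simp add: continuous_on_closed_vimage)
  then have "compact ?R" by (intro compact_Int_closed) auto
  moreover obtain s where "0 \<le> s" "s \<le> \<epsilon>" "X s (X \<theta> x) \<in> TT"
    using hits_forward by blast
  then have "s + \<theta> \<in> ?R" by (simp add: flow_flow)
  then have "?R \<noteq> {}" by blast
  ultimately obtain m where m: "m \<in> ?R" "\<And>t. t \<in> ?R \<Longrightarrow> m \<le> t"
    using compact_attains_inf by metis
  have "m \<le> t" if "0 < t" "X t x \<in> TT" for t
  proof (cases "t \<le> \<theta> + \<epsilon>")
    case True
    have "\<theta> \<le> t"
      using SS_gap_pos[of x t] assms that TT_subset_SS by force
    then show ?thesis using m(2) True that by simp
  qed (use m(1) in auto)
  then show ?thesis using that m(1) by auto
qed

lemma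
  assumes "x \<in> TT"
  shows ret_time_ge: "\<theta> \<le> ret_time x"
    and ret_time_le: "ret_time x \<le> \<theta> + \<epsilon>"
    and ret_time_in: "X (ret_time x) x \<in> TT"
    and ret_time_least: "0 < t \<Longrightarrow> X t x \<in> TT \<Longrightarrow> ret_time x \<le> t"
proof -
  obtain m where m: "\<theta> \<le> m" "m \<le> \<theta> + \<epsilon>" "X m x \<in> TT" "\<And>t. 0 < t \<Longrightarrow> X t x \<in> TT \<Longrightarrow> m \<le> t"
    using ret_time_aux[OF assms] by blast
  have "ret_time x = m"
    unfolding ret_time_def using m theta_pos by (intro Least_equality) auto
  then show "\<theta> \<le> ret_time x" "ret_time x \<le> \<theta> + \<epsilon>" "X (ret_time x) x \<in> TT"
    "0 < t \<Longrightarrow> X t x \<in> TT \<Longrightarrow> ret_time x \<le> t"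
    using m by auto
qed

lemma return_map_eq: "\<phi> x = X (ret_time x) x"
  by (simp add: return_map_def ret_time_def)

lemma ret_time_pos: "x \<in> TT \<Longrightarrow> 0 < ret_time x"
  using less_le_trans[OF theta_pos ret_time_ge] .

lemma hit_time_return_map:
  assumes "x \<in> TT"
  shows "hit_time X x (\<phi> x) = ret_time x"
  unfolding hit_time_def
proof (rule Least_equality)
  fix t assume "0 < t \<and> \<phi> x = X t x"
  then show "ret_time x \<le> t"
    using ret_time_least[OF assms, of t] ret_time_in[OF assms] by (metis return_map_eq)
qed (use ret_time_pos[OF assms] in \<open>simp add: return_map_eq\<close>)

text \<open>Of two points with the same image, one with a longer return time would pass through the
  other too early. A preimage of \<open>z\<close> is the most recent earlier hit, found by the same
  compactness argument in backward time.\<close>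

lemma return_map_bij: "bij_betw \<phi> TT TT"
proof -
  have less: "False" if xy: "x \<in> TT" "y \<in> TT" "\<phi> x = \<phi> y" "ret_time x < ret_time y" for x y
  proof -
    have "x = X (- ret_time x) (X (ret_time y) y)"
      using xy(3) unfolding return_map_eq by (metis flow_inverse(1))
    then have "X (ret_time y - ret_time x) y \<in> TT"
      using xy(1) by (simp add: flow_flow)
    then show False
      using ret_time_least[OF xy(2), of "ret_time y - ret_time x"] xy ret_time_pos[OF xy(1)] by simp
  qed
  have inj: "inj_on \<phi> TT"
  proof (rule inj_onI)
    fix x y assume xy: "x \<in> TT" "y \<in> TT" "\<phi> x = \<phi> y"
    then have "ret_time x = ret_time y"
      using less by (metis linorder_neqE_linordered_idom)
    then show "x = y" using xy(3) by (metis flow_inverse(1) return_map_eq)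
  qed
  have "z \<in> \<phi> ` TT" if z: "z \<in> TT" for z
  proof -
    let ?R = "{\<theta>..\<theta> + \<epsilon>} \<inter> (\<lambda>t. X (- t) z) -` TT"
    have "continuous_on UNIV (\<lambda>t. X (- t) z)" by (intro continuous_intros)
    then have "closed ((\<lambda>t. X (- t) z) -` TT)"
      using closed_TT by (simp add: continuous_on_closed_vimage)
    then have "compact ?R" by (intro compact_Int_closed) auto
    moreover obtain s where "0 \<le> s" "s \<le> \<epsilon>" "X (- s) (X (- \<theta>) z) \<in> TT"
      using hits_backward by blast
    then have "s + \<theta> \<in> ?R" by (simp add: flow_flow)
    then have "?R \<noteq> {}" by blast
    ultimately obtain m where m: "m \<in> ?R" "\<And>t. t \<in> ?R \<Longrightarrow> m \<le> t"
      using compact_attains_inf by metis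
    let ?x = "X (- m) z"
    have x: "?x \<in> TT" using m(1) by simp
    have "ret_time ?x = m"
    proof (rule antisym)
      show "ret_time ?x \<le> m"
        using ret_time_least[OF x, of m] m(1) theta_pos z by simp
      show "m \<le> ret_time ?x"
      proof (rule ccontr)
        assume "\<not> m \<le> ret_time ?x"
        then have less: "0 < m - ret_time ?x" by simp
        have in_TT: "X (- (m - ret_time ?x)) z \<in> TT"
          using ret_time_in[OF x] by (simp add: flow_flow)
        have "\<theta> \<le> m - ret_time ?x"
          using SS_gap[of z "- (m - ret_time ?x)", OF subsetD[OF TT_subset_SS z] subsetD[OF TT_subset_SS in_TT]]
            less by linarith
        then have "m - ret_time ?x \<in> ?R"
          using in_TT m(1) ret_time_pos[OF x] by simp
        then show False using m(2) ret_time_pos[OF x] by fastforce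
      qed
    qed
    then have "z = \<phi> ?x" by (simp add: return_map_eq)
    then show ?thesis using x by (rule image_eqI)
  qed
  moreover have "\<phi> ` TT \<subseteq> TT" using ret_time_in by (auto simp: return_map_eq)
  ultimately show ?thesis using inj by (auto simp: bij_betw_def)
qed

text \<open>Negative iterates are powers of \<open>inv_into\<close>; there the step identity rests
  on surjectivity of the return map.\<close>

lemma
  assumes "x \<in> TT"
  shows return_iter_0 [simp]: "orb 0 x = x"
    and return_iter_in: "orb j x \<in> TT"
    and return_iter_step: "orb (j + 1) x = \<phi> (orb j x)"
proof -
  let ?\<psi> = "inv_into TT \<phi>"
  have \<phi>: "\<phi> y \<in> TT" "?\<psi> y \<in> TT" "\<phi> (?\<psi> y) = y" if "y \<in> TT" for y
    using imageI[OF that, of \<phi>] inv_into_into[of y \<phi> TT] f_inv_into_f[of y \<phi> TT] that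
      bij_betw_imp_surj_on[OF return_map_bij] by simp_all
  have pow: "(\<phi> ^^ n) x \<in> TT" "(?\<psi> ^^ n) x \<in> TT" for n
  proof (induction n)
    case (Suc n)
    show "(\<phi> ^^ Suc n) x \<in> TT" using \<phi>(1)[OF Suc(1)] by simp
    show "(?\<psi> ^^ Suc n) x \<in> TT" using \<phi>(2)[OF Suc(2)] by simp
  qed (use assms in simp_all)
  show "orb 0 x = x" by (simp add: return_iter_def)
  show "orb j x \<in> TT" unfolding return_iter_def using pow by simp
  show "orb (j + 1) x = \<phi> (orb j x)"
  proof (cases "0 \<le> j")
    case True
    then show ?thesis by (simp add: return_iter_def nat_add_distrib)
  next
    case False
    then obtain n where n: "j = - int (Suc n)"
      by (cases j) auto
    have "\<phi> (orb j x) = (?\<psi> ^^ n) x"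
      unfolding n return_iter_def using \<phi>(3)[OF pow(2)[of n]] by (simp add: nat_add_distrib)
    moreover have "orb (j + 1) x = (?\<psi> ^^ n) x"
      unfolding n return_iter_def by (cases n) (auto simp: nat_add_distrib)
    ultimately show ?thesis by simp
  qed
qed

lemma orbit_times:
  assumes "x \<in> TT"
  obtains G where "G 0 = 0" "\<And>j. G (j + 1) = G j + ret_time (orb j x)" "\<And>j. orb j x = X (G j) x"
proof -
  obtain G where G: "G 0 = 0" "\<And>j. G (j + 1) = G j + ret_time (orb j x)"
    using int_primitive[of "\<lambda>j. ret_time (orb j x)"] by auto
  have "orb j x = X (G j) x" for j
  proof (induction j rule: int_steps_induct)
    case base
    show ?case unfolding G(1) return_iter_0[OF assms] by simp
  next
    case (up j)
    have "orb (j + 1) x = X (ret_time (orb j x)) (X (G j) x)"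
      unfolding return_iter_step[OF assms, of j] return_map_eq by (simp only: up.IH)
    also have "\<dots> = X (G (j + 1)) x"
      unfolding flow_flow G(2) by (simp only: add.commute)
    finally show ?case .
  next
    case (down j)
    have "X (G j) x = X (ret_time (orb (j - 1) x)) (orb (j - 1) x)"
      using return_iter_step[OF assms, of "j - 1"] unfolding return_map_eq by (simp only: down.IH diff_add_cancel)
    then have "orb (j - 1) x = X (- ret_time (orb (j - 1) x)) (X (G j) x)"
      by (simp only: flow_inverse)
    also have "\<dots> = X (G (j - 1)) x"
      using G(2)[of "j - 1"] unfolding flow_flow by simp
    finally show ?case .
  qed
  with G show ?thesis by (rule that)
qed

lemma hit_time_orbit:
  assumes "x \<in> TT"
  shows "hit_time X (orb j x) (orb (j + 1) x) = ret_time (orb j x)"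
  using hit_time_return_map[OF return_iter_in[OF assms, of j]] return_iter_step[OF assms, of j] by simp

subsection \<open>Following sequences\<close>

text \<open>Two section hits of \<open>w\<close> within \<open>\<rho>\<close> are less than
  \<open>2 * \<rho> < \<theta>\<close> apart in time and so coincide. Hence a hit of any section at
  all is already the projection to \<open>S l\<close>.\<close>

lemma proj_eqI:
  assumes "l \<in> {1..k}" "w \<in> Dset X \<rho> (S l)" "X t w \<in> SS" "\<bar>t\<bar> < \<rho>"
  shows "proj X \<rho> (S l) w = X t w" "X t w \<in> S l"
proof -
  obtain u where u: "\<bar>u\<bar> < \<rho>" "X u w \<in> S l"
    using assms(2) by (rule DsetE)
  define s b where "s = - u" and "b = X u w"
  then have sb: "\<bar>s\<bar> < \<rho>" "b \<in> S l" "w = X s b" using u by simp_all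
  have uniq: "X u w = b" if "\<bar>u\<bar> < \<rho>" "X u w \<in> SS" for u
  proof -
    have "X (u + s) b \<in> SS" using that sb by (simp add: flow_flow)
    moreover have "\<bar>u + s\<bar> < \<theta>" using that sb rho_less by linarith
    ultimately have "u + s = 0" using SS_gap[of b "u + s"] sb assms(1) by blast
    then show ?thesis using sb by (simp add: flow_flow)
  qed
  have b: "b = X (- s) w" using sb by simp
  have tb: "X t w = b" using uniq assms by blast
  show "X t w \<in> S l" using tb sb by simp
  have "proj X \<rho> (S l) w = b"
    unfolding proj_def
  proof (rule the_equality)
    show "b \<in> S l \<and> (\<exists>t. \<bar>t\<bar> < \<rho> \<and> b = X t w)" using sb b by (metis abs_minus_cancel)
    show "v = b" if "v \<in> S l \<and> (\<exists>t. \<bar>t\<bar> < \<rho> \<and> v = X t w)" for v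
      using that uniq assms(1) by blast
  qed
  with tb show "proj X \<rho> (S l) w = X t w" by simp
qed

lemma Dset_proj:
  assumes "l \<in> {1..k}" "w \<in> Dset X \<rho> (S l)"
  obtains t where "\<bar>t\<bar> < \<rho>" "X t w \<in> S l" "proj X \<rho> (S l) w = X t w"
proof -
  obtain s where "\<bar>s\<bar> < \<rho>" "X s w \<in> S l"
    using assms(2) by (rule DsetE)
  then show ?thesis
    using that[of s] proj_eqI[OF assms, of s] assms(1) by blast
qed

lemma following_0:
  assumes "following X k S T \<rho> \<epsilon>0 x y 0 z"
  shows "z = y"
  using assms by (cases rule: following.cases) auto

text \<open>Inverts one forward step and replaces the projection by the time correction
  \<open>t\<close> that it amounts to.\<close>

lemma following_up:
  assumes "following X k S T \<rho> \<epsilon>0 x y (j + 1) z" "0 \<le> j" "x \<in> TT"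
  obtains z' l t where "following X k S T \<rho> \<epsilon>0 x y j z'" "\<bar>t\<bar> < \<rho>" "l \<in> {1..k}"
    "orb (j + 1) x \<in> T l" "z = X (ret_time (orb j x) + t) z'" "z \<in> S l"
  using assms(1)
proof (cases rule: following.cases)
  case (forward j' z' l w)
  then have [simp]: "j' = j" by simp
  obtain t where t: "\<bar>t\<bar> < \<rho>" "X t w \<in> S l" "proj X \<rho> (S l) w = X t w"
    using Dset_proj forward by metis
  show ?thesis
    by (rule that[of z' t l]) (use forward t hit_time_orbit[OF assms(3), of j] in \<open>auto simp: flow_flow add.commute\<close>)
qed (use assms(2) in auto)

lemma following_down:
  assumes "following X k S T \<rho> \<epsilon>0 x y (j - 1) z" "j \<le> 0" "x \<in> TT"
  obtains z' l t where "following X k S T \<rho> \<epsilon>0 x y j z'" "\<bar>t\<bar> < \<rho>" "l \<in> {1..k}"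
    "orb (j - 1) x \<in> T l" "z = X (- ret_time (orb (j - 1) x) + t) z'" "z \<in> S l"
  using assms(1)
proof (cases rule: following.cases)
  case (backward j' z' l w)
  then have [simp]: "j' = j" by simp
  obtain t where t: "\<bar>t\<bar> < \<rho>" "X t w \<in> S l" "proj X \<rho> (S l) w = X t w"
    using Dset_proj backward by metis
  show ?thesis
    by (rule that[of z' t l])
      (use backward t hit_time_orbit[OF assms(3), of "j - 1"] in \<open>auto simp: flow_flow add.commute\<close>)
qed (use assms(2) in auto)

lemma close_points_eq:
  assumes "X (c + s) w \<in> SS" "X (c + t) w \<in> SS" "\<bar>s\<bar> < \<rho>" "\<bar>t\<bar> < \<rho>"
  shows "X (c + s) w = X (c + t) w"
proof -
  have "X (t - s) (X (c + s) w) \<in> SS" using assms(2) by (simp add: flow_flow add.commute)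
  moreover have "\<bar>t - s\<bar> < \<theta>" using assms rho_less by linarith
  ultimately have "t - s = 0" using SS_gap assms(1) by blast
  then show ?thesis by simp
qed

text \<open>The relation leaves the choice of section free, but corrections from two choices differ
  by less than \<open>2 * \<rho>\<close>.\<close>

lemma following_unique:
  assumes "following X k S T \<rho> \<epsilon>0 x y j z" "following X k S T \<rho> \<epsilon>0 x y j z'" "x \<in> TT"
  shows "z = z'"
  using assms(1,2)
proof (induction j arbitrary: z z' rule: int_steps_induct)
  case base
  then show ?case using following_0 by blast
next
  case (up j)
  obtain u l t where u: "following X k S T \<rho> \<epsilon>0 x y j u" "\<bar>t\<bar> < \<rho>" "l \<in> {1..k}"
    "z = X (ret_time (orb j x) + t) u" "z \<in> S l"
    using following_up[OF up.prems(1) up.hyps(1) assms(3)] by metis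
  obtain u' l' t' where u': "following X k S T \<rho> \<epsilon>0 x y j u'" "\<bar>t'\<bar> < \<rho>" "l' \<in> {1..k}"
    "z' = X (ret_time (orb j x) + t') u'" "z' \<in> S l'"
    using following_up[OF up.prems(2) up.hyps(1) assms(3)] by metis
  have "u = u'" using up.IH u(1) u'(1) by blast
  then show ?case using close_points_eq[of _ t u t'] u u' by blast
next
  case (down j)
  obtain u l t where u: "following X k S T \<rho> \<epsilon>0 x y j u" "\<bar>t\<bar> < \<rho>" "l \<in> {1..k}"
    "z = X (- ret_time (orb (j - 1) x) + t) u" "z \<in> S l"
    using following_down[OF down.prems(1) down.hyps(1) assms(3)] by metis
  obtain u' l' t' where u': "following X k S T \<rho> \<epsilon>0 x y j u'" "\<bar>t'\<bar> < \<rho>" "l' \<in> {1..k}"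
    "z' = X (- ret_time (orb (j - 1) x) + t') u'" "z' \<in> S l'"
    using following_down[OF down.prems(2) down.hyps(1) assms(3)] by metis
  have "u = u'" using down.IH u(1) u'(1) by blast
  then show ?case using close_points_eq[of _ t u t'] u u' by blast
qed

text \<open>A complete following sequence with projections recorded as time corrections. The step
  can be inverted, so both time directions are treated at once; closeness to the orbit of
  \<open>x\<close> is stated separately.\<close>

definition chain :: "'a \<Rightarrow> (int \<Rightarrow> 'a) \<Rightarrow> bool" where
  "chain x z \<longleftrightarrow> (\<forall>j. (\<exists>l\<in>{1..k}. orb j x \<in> T l \<and> z j \<in> S l) \<and>
     (\<exists>s. \<bar>s\<bar> < \<rho> \<and> z (j + 1) = X (ret_time (orb j x) + s) (z j)))"

text \<open>Each \<open>z (j + 1)\<close> is a section point within time \<open>\<rho>\<close> of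
  the transported \<open>z j\<close>, so \<open>proj_eqI\<close> recognises it as the projection.
  Backward steps use the opposite correction.\<close>

lemma following_chain:
  assumes x: "x \<in> TT" and chain: "chain x z" and close: "\<And>j. dist (orb j x) (z j) < \<epsilon>0"
  shows "following X k S T \<rho> \<epsilon>0 x (z 0) j (z j)"
proof (induction j rule: int_steps_induct)
  case base
  show ?case using close[of 0] x by (intro following.start) simp
next
  case (up j)
  obtain l s where l: "l \<in> {1..k}" "orb (j + 1) x \<in> T l" "z (j + 1) \<in> S l"
    "\<bar>s\<bar> < \<rho>" "z (j + 1) = X (ret_time (orb j x) + s) (z j)"
    using chain unfolding chain_def by metis
  let ?w = "X (hit_time X (orb j x) (orb (j + 1) x)) (z j)"
  have z: "z (j + 1) = X s ?w"
    using l(5) hit_time_orbit[OF x, of j] by (simp add: flow_flow add.commute)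
  have w: "?w \<in> Dset X \<rho> (S l)" using DsetI[of s] z l by simp
  have "proj X \<rho> (S l) ?w = z (j + 1)"
    using proj_eqI(1)[OF l(1) w, of s] z l by (metis UN_I)
  then show ?case
    using following.forward[OF up.IH up.hyps close l(1,2) refl w] by simp
next
  case (down j)
  obtain l where l: "l \<in> {1..k}" "orb (j - 1) x \<in> T l" "z (j - 1) \<in> S l"
    using chain unfolding chain_def by metis
  obtain s where s: "\<bar>s\<bar> < \<rho>" "z (j - 1 + 1) = X (ret_time (orb (j - 1) x) + s) (z (j - 1))"
    using chain unfolding chain_def by blast
  let ?w = "X (- hit_time X (orb (j - 1) x) (orb j x)) (z j)"
  have z: "z (j - 1) = X (- s) ?w"
    using s(2) hit_time_orbit[OF x, of "j - 1"] by (simp add: flow_flow)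
  have w: "?w \<in> Dset X \<rho> (S l)" using DsetI[of "-s"] z l s by simp
  have "proj X \<rho> (S l) ?w = z (j - 1)"
    using proj_eqI(1)[OF l(1) w, of "-s"] z l s by (metis UN_I abs_minus_cancel)
  then show ?case
    using following.backward[OF down.IH down.hyps close l(1,2) refl w] by simp
qed

abbreviation "W \<epsilon>0 \<eta> i x \<equiv> stable_set X k S T \<rho> \<epsilon>0 \<eta> i x \<inter> unstable_set X k S T \<rho> \<epsilon>0 \<eta> i x"

lemma chain_in_stable_unstable:
  assumes "x \<in> TT" "chain x z" "\<And>j. dist (orb j x) (z j) < \<eta>" "\<eta> < \<epsilon>0" "z 0 \<in> S i"
  shows "z 0 \<in> W \<epsilon>0 \<eta> i x"
proof -
  have "dist (orb j x) (z j) < \<epsilon>0" for j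
    using assms(3,4) less_trans by blast
  then have "following X k S T \<rho> \<epsilon>0 x (z 0) j (z j)" for j
    by (rule following_chain[OF assms(1,2)])
  then show ?thesis
    using assms unfolding stable_set_def unstable_set_def by blast
qed

text \<open>The one-sided sequences are glued at index 0. Uniqueness identifies the predecessor
  inside each derivation with the chosen \<open>z j\<close>.\<close>

lemma stable_unstable_chain:
  assumes "x \<in> TT" "y \<in> W \<epsilon>0 \<eta> i x" "i \<in> {1..k}" "x \<in> T i"
  obtains z where "z 0 = y" "chain x z" "\<And>j. dist (orb j x) (z j) < \<eta>"
proof -
  have "\<exists>z. following X k S T \<rho> \<epsilon>0 x y j z \<and> dist (orb j x) z < \<eta>" for j
    using assms(2) unfolding stable_set_def unstable_set_def by (cases "0 \<le> j") auto
  then obtain z where z: "\<And>j. following X k S T \<rho> \<epsilon>0 x y j (z j)" "\<And>j. dist (orb j x) (z j) < \<eta>"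
    by metis
  have z0: "z 0 = y" using following_0 z(1) by blast
  have up: "(\<exists>l\<in>{1..k}. orb (j + 1) x \<in> T l \<and> z (j + 1) \<in> S l) \<and>
    (\<exists>s. \<bar>s\<bar> < \<rho> \<and> z (j + 1) = X (ret_time (orb j x) + s) (z j))" if j: "0 \<le> j" for j
  proof -
    obtain z' l t where "following X k S T \<rho> \<epsilon>0 x y j z'" "\<bar>t\<bar> < \<rho>" "l \<in> {1..k}"
      "orb (j + 1) x \<in> T l" "z (j + 1) = X (ret_time (orb j x) + t) z'" "z (j + 1) \<in> S l"
      using following_up[OF z(1) j assms(1)] by metis
    then show ?thesis using following_unique[OF z(1) _ assms(1)] by metis
  qed
  have down: "(\<exists>l\<in>{1..k}. orb (j - 1) x \<in> T l \<and> z (j - 1) \<in> S l) \<and>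
    (\<exists>s. \<bar>s\<bar> < \<rho> \<and> z (j - 1 + 1) = X (ret_time (orb (j - 1) x) + s) (z (j - 1)))" if j: "j \<le> 0" for j
  proof -
    obtain z' l t where *: "following X k S T \<rho> \<epsilon>0 x y j z'" "\<bar>t\<bar> < \<rho>" "l \<in> {1..k}"
      "orb (j - 1) x \<in> T l" "z (j - 1) = X (- ret_time (orb (j - 1) x) + t) z'" "z (j - 1) \<in> S l"
      using following_down[OF z(1) j assms(1)] by metis
    have "z j = z'" using following_unique[OF z(1) _ assms(1)] *(1) by metis
    then have "z j = X (ret_time (orb (j - 1) x) + (- t)) (z (j - 1))"
      using *(5) by (simp add: flow_flow)
    then show ?thesis using * by (metis abs_minus_cancel diff_add_cancel)
  qed
  have "(\<exists>l\<in>{1..k}. orb j x \<in> T l \<and> z j \<in> S l) \<and>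
    (\<exists>s. \<bar>s\<bar> < \<rho> \<and> z (j + 1) = X (ret_time (orb j x) + s) (z j))" for j
  proof -
    consider "j = 0" | "0 < j" | "j < 0" by linarith
    then show ?thesis
    proof cases
      case 1
      \<comment> \<open>No step of the construction leads into index 0, so membership in a section
        comes from \<open>y \<in> S i\<close> and \<open>x \<in> T i\<close>.\<close>
      then have "\<exists>l\<in>{1..k}. orb j x \<in> T l \<and> z j \<in> S l"
        using assms z0 unfolding stable_set_def by auto
      then show ?thesis using up[of j] 1 by simp
    next
      case 2
      \<comment> \<open>The step out of \<open>j\<close> gives the time relation, the step into
        \<open>j\<close> the section.\<close>
      then show ?thesis using up[of j] up[of "j - 1"] by simp
    next
      case 3
      then show ?thesis using down[of "j + 1"] by simp
    qed
  qed
  then have "chain x z" unfolding chain_def by blast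
  then show ?thesis using that z0 z(2) by blast
qed

end

section \<open>Expansivity bounds the local intersections\<close>

text \<open>A monotone function onto the line has no jumps; this applies to the inverse as
  well.\<close>

lemma homeomorphism_strict_mono_surj:
  fixes f :: "real \<Rightarrow> real"
  assumes "strict_mono f" "surj f"
  shows "homeomorphism UNIV UNIV f (inv f)"
proof -
  have inj: "inj f" using assms(1) by (rule strict_mono_imp_inj_on)
  have cont: "continuous_on UNIV f"
    using assms by (intro continuous_onI_mono) (auto simp: strict_mono_less_eq)
  have "inv f x \<le> inv f y" if "x \<le> y" for x y
    using that assms by (metis strict_mono_less_eq surj_f_inv_f)
  then have "continuous_on UNIV (inv f)"
    using inj by (intro continuous_onI_mono) (auto simp: inj_imp_surj_inv)
  then show ?thesis
    using cont inj assms(2) by (auto simp: homeomorphism_def inj_imp_surj_inv surj_f_inv_f)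
qed

section \<open>Piecewise linear reparametrisations\<close>

definition interpolate :: "(int \<Rightarrow> real) \<Rightarrow> real \<Rightarrow> real" where
  "interpolate a u = a \<lfloor>u\<rfloor> + frac u * (a (\<lfloor>u\<rfloor> + 1) - a \<lfloor>u\<rfloor>)"

lemma interpolate_0 [simp]: "interpolate a 0 = a 0"
  by (simp add: interpolate_def)

text \<open>The uniform gap makes the sequence unbounded in both directions, hence its interpolation
  surjective.\<close>

locale increasing_sequence =
  fixes a :: "int \<Rightarrow> real" and c :: real
  assumes c_pos: "0 < c" and gap: "\<And>j. a j + c \<le> a (j + 1)"
begin

lemma growth: "0 \<le> n \<Longrightarrow> a j + n * c \<le> a (j + n)"
proof (induction n rule: int_ge_induct)
  case (step n)
  then show ?case using gap[of "j + n"] by (simp add: algebra_simps)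
qed simp

lemma a_mono: "i \<le> j \<Longrightarrow> a i \<le> a j"
  using growth[of "j - i" i] c_pos by (smt (verit) add_diff_cancel_left' diff_add_cancel add.commute mult_nonneg_nonneg of_int_0_le_iff diff_ge_0_iff_ge)

lemma strict_mono_interpolate: "strict_mono (interpolate a)"
proof (rule strict_monoI)
  fix u v :: real assume "u < v"
  have pos: "0 < a (\<lfloor>w\<rfloor> + 1) - a \<lfloor>w\<rfloor>" for w :: real
    using gap[of "\<lfloor>w\<rfloor>"] c_pos by simp
  have ge: "a \<lfloor>w\<rfloor> \<le> interpolate a w" for w
    unfolding interpolate_def using pos[of w] frac_ge_0[of w] by simp
  have less: "interpolate a w < a (\<lfloor>w\<rfloor> + 1)" for w
    unfolding interpolate_def using mult_strict_right_mono[OF frac_lt_1[of w] pos[of w]] by simp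
  show "interpolate a u < interpolate a v"
  proof (cases "\<lfloor>u\<rfloor> = \<lfloor>v\<rfloor>")
    case True
    then have "frac u < frac v" using \<open>u < v\<close> by (simp add: frac_def)
    then show ?thesis
      using mult_strict_right_mono[OF _ pos[of v]] unfolding interpolate_def True by simp
  next
    case False
    then have "\<lfloor>u\<rfloor> + 1 \<le> \<lfloor>v\<rfloor>" using floor_mono[of u v] \<open>u < v\<close> by linarith
    then show ?thesis using less[of u] a_mono ge[of v] by force
  qed
qed

lemma surj_interpolate: "surj (interpolate a)"
proof -
  have "\<exists>u. interpolate a u = y" for y
  proof -
    obtain n :: nat where "\<bar>y - a 0\<bar> < real n * c"
      using reals_Archimedean3[OF c_pos] by blast
    then have n: "a (- int n) \<le> y" "y < a (int n)"
      using growth[of "int n" "- int n"] growth[of "int n" 0] by auto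
    let ?J = "{j \<in> {- int n..int n}. a j \<le> y}"
    define j where "j = Max ?J"
    have "finite ?J" by (rule finite_subset[of _ "{- int n..int n}"]) auto
    moreover have "- int n \<in> ?J" using n by simp
    ultimately have j: "j \<in> ?J" and max: "\<And>i. i \<in> ?J \<Longrightarrow> i \<le> j"
      unfolding j_def using Max_in[of ?J] Max_ge[of ?J] by blast+
    have "j \<noteq> int n" using j n by auto
    then have less: "y < a (j + 1)" using max[of "j + 1"] j by force
    define r where "r = (y - a j) / (a (j + 1) - a j)"
    have pos: "0 < a (j + 1) - a j" using gap[of j] c_pos by simp
    have r: "0 \<le> r" "r < 1" "r * (a (j + 1) - a j) = y - a j"
      using j less pos by (auto simp: r_def field_simps)
    have "\<lfloor>j + r\<rfloor> = j" "frac (j + r) = r" using r by (auto simp: frac_eq floor_eq_iff frac_unique_iff)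
    then show ?thesis using r by (auto simp: interpolate_def intro!: exI[of _ "j + r"])
  qed
  then show ?thesis by (metis surjI)
qed

end

context section_system
begin

text \<open>With \<open>a\<close> and \<open>b\<close> the visiting times of the two orbits,
  \<open>h\<close> sends \<open>a j\<close> to \<open>b j\<close> and is affine in between. This is
  why \<open>close\<close> compares points at equal relative positions \<open>r\<close>.\<close>

lemma chain_reparam:
  assumes x: "x \<in> TT"
    and z: "\<And>j. z (j + 1) = X (ret_time (orb j x) + \<sigma> j) (z j)"
    and \<sigma>: "\<And>j. \<bar>\<sigma> j\<bar> < \<rho>"
    and close: "\<And>j r. 0 \<le> r \<Longrightarrow> r \<le> 1 \<Longrightarrow>
      dist (X (r * ret_time (orb j x)) (orb j x)) (X (r * (ret_time (orb j x) + \<sigma> j)) (z j)) < e"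
  obtains h where "h \<in> Hom0" "\<And>t. dist (X t x) (X (h t) (z 0)) < e"
proof -
  let ?g = "\<lambda>j. ret_time (orb j x)"
  obtain a where a: "a 0 = 0" "\<And>j. a (j + 1) = a j + ?g j" "\<And>j. orb j x = X (a j) x"
    using orbit_times[OF x] by blast
  obtain b where b: "b 0 = 0" "\<And>j. b (j + 1) = b j + (?g j + \<sigma> j)"
    using int_primitive[of "\<lambda>j. ?g j + \<sigma> j"] by auto
  have zb: "z j = X (b j) (z 0)" for j
  proof (induction j rule: int_steps_induct)
    case base
    show ?case by (simp add: b(1))
  next
    case (up j)
    have "z (j + 1) = X (?g j + \<sigma> j) (X (b j) (z 0))"
      unfolding z[of j] by (simp only: up.IH[symmetric])
    then show ?case unfolding b(2) flow_flow by (simp only: add.commute)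
  next
    case (down j)
    have "X (?g (j - 1) + \<sigma> (j - 1)) (z (j - 1)) = X (b j) (z 0)"
      using z[of "j - 1"] down.IH by simp
    then have "z (j - 1) = X (- (?g (j - 1) + \<sigma> (j - 1))) (X (b j) (z 0))"
      by (metis flow_inverse(1))
    then show ?case using b(2)[of "j - 1"] by (simp add: flow_flow algebra_simps)
  qed
  have g: "\<theta> \<le> ?g j" for j
    by (rule ret_time_ge[OF return_iter_in[OF x]])
  interpret a: increasing_sequence a \<theta>
    by unfold_locales (use g theta_pos a in auto)
  interpret b: increasing_sequence b \<rho>
  proof
    \<comment> \<open>Return times are at least \<open>\<theta> > 2 * \<rho>\<close>, and a
      correction takes away less than \<open>\<rho>\<close>.\<close>
    show "b j + \<rho> \<le> b (j + 1)" for j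
      using g[of j] \<sigma>[of j] b(2)[of j] rho_less by linarith
  qed (rule rho_pos)
  let ?i = "inv (interpolate a)"
  let ?h = "interpolate b \<circ> ?i"
  have inj: "inj (interpolate a)"
    using a.strict_mono_interpolate by (rule strict_mono_imp_inj_on)
  have i: "interpolate a (?i t) = t" for t
    by (simp add: a.surj_interpolate surj_f_inv_f)
  have "homeomorphism UNIV UNIV ?h (interpolate a \<circ> inv (interpolate b))"
    using homeomorphism_compose[OF
        homeomorphism_sym[THEN iffD1, OF homeomorphism_strict_mono_surj[OF a.strict_mono_interpolate a.surj_interpolate]]
        homeomorphism_strict_mono_surj[OF b.strict_mono_interpolate b.surj_interpolate]] .
  moreover have "?h 0 = 0"
    using inv_f_f[OF inj, of 0] a(1) b(1) by simp
  ultimately have "?h \<in> Hom0" unfolding Hom0_def by blast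
  moreover have "dist (X t x) (X (?h t) (z 0)) < e" for t
  proof -
    define j r where "j = \<lfloor>?i t\<rfloor>" and "r = frac (?i t)"
    have r: "0 \<le> r" "r \<le> 1" using frac_lt_1[of "?i t"] by (auto simp: r_def)
    have "t = interpolate a (?i t)" by (simp only: i)
    also have "\<dots> = a j + r * ?g j"
      unfolding interpolate_def[of a "?i t"] using a(2)[of j] by (simp add: j_def r_def)
    finally have 1: "X t x = X (r * ?g j) (orb j x)"
      by (simp only: a(3)[of j] flow_flow add.commute)
    have "?h t = b j + r * (?g j + \<sigma> j)"
      unfolding comp_def interpolate_def[of b "?i t"] using b(2)[of j] by (simp add: j_def r_def)
    then have 2: "X (?h t) (z 0) = X (r * (?g j + \<sigma> j)) (z j)"
      by (simp only: zb[of j] flow_flow add.commute)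
    show ?thesis unfolding 1 2 using close r by blast
  qed
  ultimately show ?thesis by (rule that)
qed

text \<open>With zero corrections, \<open>x\<close> is a member of its own local intersection; it
  will carry the identity reparametrisation.\<close>

lemma orbit_chain: "x \<in> TT \<Longrightarrow> chain x (\<lambda>j. orb j x)"
  unfolding chain_def
proof (intro allI conjI)
  fix j assume x: "x \<in> TT"
  show "\<exists>l\<in>{1..k}. orb j x \<in> T l \<and> orb j x \<in> S l"
    using return_iter_in[OF x, of j] T_subset_S by blast
  show "\<exists>s. \<bar>s\<bar> < \<rho> \<and> orb (j + 1) x = X (ret_time (orb j x) + s) (orb j x)"
    using return_iter_step[OF x, of j] rho_pos by (intro exI[of _ 0]) (simp add: return_map_eq)
qed

text \<open>Consecutive points of a chain are both near the orbit of \<open>x\<close>, so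
  \<open>small_shift\<close> improves the bound \<open>\<rho>\<close> on corrections to whatever
  uniform continuity demands. Allowing all smaller \<open>\<eta>'\<close> lets the radius later be
  lowered below \<open>\<epsilon>0\<close>.\<close>

lemma stable_unstable_shadow:
  assumes "0 < e"
  obtains \<eta> where "0 < \<eta>" "\<And>\<eta>' \<epsilon>0 i x y. \<eta>' \<le> \<eta> \<Longrightarrow> i \<in> {1..k} \<Longrightarrow> x \<in> T i \<Longrightarrow> y \<in> W \<epsilon>0 \<eta>' i x
    \<Longrightarrow> \<exists>h\<in>Hom0. \<forall>t. dist (X t x) (X (h t) y) < e"
proof -
  let ?R = "\<theta> + \<epsilon> + \<rho>"
  obtain d where d: "0 < d" "\<And>s t x y. \<bar>s\<bar> \<le> ?R \<Longrightarrow> \<bar>t\<bar> \<le> ?R \<Longrightarrow> \<bar>s - t\<bar> < d \<Longrightarrow> dist x y < d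
      \<Longrightarrow> dist (X s x) (X t y) < e"
    using uniform_flow[OF assms, of ?R] by metis
  obtain \<eta> where \<eta>: "0 < \<eta>"
    "\<And>p z g s. \<bar>g\<bar> \<le> ?R \<Longrightarrow> \<bar>s\<bar> \<le> \<rho> \<Longrightarrow> dist p z < \<eta> \<Longrightarrow> dist (X g p) (X (g + s) z) < \<eta> \<Longrightarrow> \<bar>s\<bar> < d"
    using small_shift[of \<rho> d ?R] no_small_period rho_less rho_pos d(1)
    by (smt (verit, best))
  show ?thesis
  proof (rule that[of "min \<eta> d"])
    fix \<eta>' \<epsilon>0 i x y assume *: "\<eta>' \<le> min \<eta> d" "i \<in> {1..k}" "x \<in> T i" "y \<in> W \<epsilon>0 \<eta>' i x"
    then have x: "x \<in> TT" by blast
    obtain z where z: "z 0 = y" "chain x z" "\<And>j. dist (orb j x) (z j) < \<eta>'"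
      using stable_unstable_chain[OF x *(4,2,3)] by blast
    let ?g = "\<lambda>j. ret_time (orb j x)"
    obtain \<sigma> where \<sigma>: "\<And>j. \<bar>\<sigma> j\<bar> < \<rho>" "\<And>j. z (j + 1) = X (?g j + \<sigma> j) (z j)"
      using z(2) unfolding chain_def by metis
    have g: "0 < ?g j" "?g j \<le> \<theta> + \<epsilon>" for j
      using ret_time_pos[OF return_iter_in[OF x]] ret_time_le[OF return_iter_in[OF x]] by auto
    have \<sigma>d: "\<bar>\<sigma> j\<bar> < d" for j
    proof (rule \<eta>(2))
      show "\<bar>?g j\<bar> \<le> ?R" using g[of j] rho_pos by simp
      show "dist (orb j x) (z j) < \<eta>" using z(3)[of j] * by simp
      show "dist (X (?g j) (orb j x)) (X (?g j + \<sigma> j) (z j)) < \<eta>"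
        using z(3)[of "j + 1"] *(1) return_iter_step[OF x, of j] unfolding \<sigma>(2) return_map_eq by simp
    qed (use \<sigma>(1)[of j] in simp)
    have "dist (X (r * ?g j) (orb j x)) (X (r * (?g j + \<sigma> j)) (z j)) < e"
      if r: "0 \<le> r" "r \<le> 1" for j r
    proof (rule d(2))
      have scale: "\<bar>r * w\<bar> \<le> \<bar>w\<bar>" for w using r by (simp add: abs_mult mult_left_le_one_le)
      show "\<bar>r * ?g j\<bar> \<le> ?R" using scale[of "?g j"] g[of j] rho_pos by linarith
      show "\<bar>r * (?g j + \<sigma> j)\<bar> \<le> ?R"
        using scale[of "?g j + \<sigma> j"] g[of j] \<sigma>(1)[of j] theta_pos eps_pos by linarith
      show "\<bar>r * ?g j - r * (?g j + \<sigma> j)\<bar> < d"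
        using scale[of "\<sigma> j"] \<sigma>d[of j] by (simp add: algebra_simps)
      show "dist (orb j x) (z j) < d" using z(3)[of j] * by simp
    qed
    from chain_reparam[OF x \<sigma>(2,1) this] z(1)
    show "\<exists>h\<in>Hom0. \<forall>t. dist (X t x) (X (h t) y) < e" by metis
  qed (use \<eta> d in simp)
qed

lemma N_expansive_imp_card_le:
  assumes "N_expansive X N" "0 < \<epsilon>0"
  shows "\<exists>\<eta>. 0 < \<eta> \<and> \<eta> < \<epsilon>0 \<and> (\<forall>i\<in>{1..k}. \<forall>x\<in>T i. finite (W \<epsilon>0 \<eta> i x) \<and> card (W \<epsilon>0 \<eta> i x) \<le> N)"
proof -
  \<comment> \<open>Expansivity is applied with time bound \<open>\<theta>\<close>: section points
    whose time difference is smaller coincide, which will force \<open>B\<close> to be all of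
    \<open>A\<close>.\<close>
  obtain d where d: "0 < d" "\<And>A \<alpha>. \<alpha> \<in> reparams A \<Longrightarrow> (\<And>t. diameter (reparam_image X \<alpha> t A) < d) \<Longrightarrow>
        (\<exists>B\<subseteq>A. finite B \<and> card B < N + 1 \<and> A \<subseteq> flow_image X {-\<theta><..<\<theta>} B)"
    using assms(1) theta_pos unfolding N_expansive_def by meson
  \<comment> \<open>Points within \<open>d / 3\<close> of a common point give diameter at most
    \<open>2 * d / 3\<close>; a supremum needs this margin to stay strictly below
    \<open>d\<close>.\<close>
  have "0 < d / 3" using d(1) by simp
  from stable_unstable_shadow[OF this] obtain \<eta>1 where \<eta>1: "0 < \<eta>1"
    "\<And>\<eta>' \<epsilon>0 i x y. \<eta>' \<le> \<eta>1 \<Longrightarrow> i \<in> {1..k} \<Longrightarrow> x \<in> T i \<Longrightarrow> y \<in> W \<epsilon>0 \<eta>' i x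
      \<Longrightarrow> \<exists>h\<in>Hom0. \<forall>t. dist (X t x) (X (h t) y) < d / 3" by metis
  define \<eta> where "\<eta> = min \<eta>1 (\<epsilon>0 / 2)"
  have \<eta>: "0 < \<eta>" "\<eta> < \<epsilon>0" "\<eta> \<le> \<eta>1" using \<eta>1(1) assms(2) by (auto simp: \<eta>_def)
  have "finite (W \<epsilon>0 \<eta> i x) \<and> card (W \<epsilon>0 \<eta> i x) \<le> N" if ix: "i \<in> {1..k}" "x \<in> T i" for i x
  proof (rule ccontr)
    let ?W = "W \<epsilon>0 \<eta> i x"
    assume not: "\<not> (finite ?W \<and> card ?W \<le> N)"
    have x: "x \<in> TT" using ix by blast
    have xW: "x \<in> ?W"
      using chain_in_stable_unstable[OF x orbit_chain[OF x], of \<eta> \<epsilon>0 i] \<eta> T_subset_S ix x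
      by (simp add: subset_iff)
    have "\<exists>A'\<subseteq>?W - {x}. finite A' \<and> card A' = N"
    proof (cases "finite ?W")
      case True
      then have "N \<le> card (?W - {x})" using not xW by simp
      then show ?thesis using obtain_subset_with_card_n by metis
    next
      case False
      then show ?thesis using infinite_arbitrarily_large[of "?W - {x}" N] by (metis infinite_remove)
    qed
    then obtain A' where A': "A' \<subseteq> ?W - {x}" "finite A'" "card A' = N" by blast
    \<comment> \<open>Finiteness of \<open>A\<close> makes any choice of reparametrisations
      continuous in the point.\<close>
    define A where "A = insert x A'"
    have A: "finite A" "card A = N + 1" "A \<subseteq> ?W" "x \<in> A"
      using A' xW by (auto simp: A_def card_insert_if)
    have "\<forall>y\<in>A. \<exists>h\<in>Hom0. \<forall>t. dist (X t x) (X (h t) y) < d / 3"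
      using \<eta>1(2)[OF \<eta>(3) ix] A(3) by blast
    then obtain h where h: "\<And>y. y \<in> A \<Longrightarrow> h y \<in> Hom0"
      "\<And>y t. y \<in> A \<Longrightarrow> dist (X t x) (X (h y t) y) < d / 3" by metis
    define \<alpha> where "\<alpha> y = (if y = x then id else h y)" for y
    have id: "id \<in> Hom0"
      unfolding Hom0_def using homeomorphism_ident[of UNIV] by (auto simp: id_def)
    have \<alpha>: "\<alpha> \<in> reparams A"
      using A h(1) id continuous_on_finite[OF A(1)] unfolding reparams_def by (auto simp: \<alpha>_def)
    have close: "dist (X t x) (X (\<alpha> y t) y) < d / 3" if "y \<in> A" for y t
      using h(2)[OF that] d(1) by (simp add: \<alpha>_def)
    have "diameter (reparam_image X \<alpha> t A) < d" for t
    proof -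
      let ?I = "reparam_image X \<alpha> t A"
      have ne: "?I \<noteq> {}" using A(4) by (auto simp: reparam_image_def)
      have "dist p q \<le> 2 * d / 3" if "p \<in> ?I" "q \<in> ?I" for p q
      proof -
        have "dist (X t x) p < d / 3" "dist (X t x) q < d / 3"
          using that close unfolding reparam_image_def by auto
        then show ?thesis using dist_triangle3[of p q "X t x"] by simp
      qed
      then have "diameter ?I \<le> 2 * d / 3"
        unfolding diameter_def using ne by (auto simp only: if_False intro!: cSUP_least)
      then show ?thesis using d(1) by simp
    qed
    then obtain B where B: "B \<subseteq> A" "card B < N + 1" "A \<subseteq> flow_image X {-\<theta><..<\<theta>} B"
      using d(2)[OF \<alpha>] by blast
    have AS: "A \<subseteq> SS" using A(3) ix unfolding stable_set_def by auto
    have "A \<subseteq> B"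
    proof
      fix y assume y: "y \<in> A"
      then obtain t b where t: "t \<in> {-\<theta><..<\<theta>}" "b \<in> B" "y = X t b"
        using B(3) unfolding flow_image_def by blast
      then have "t = 0" using SS_gap[of b t] AS B(1) y by (simp add: abs_less_iff subset_iff)
      then show "y \<in> B" using t by simp
    qed
    then have "A = B" using B by blast
    then show False using A B by simp
  qed
  then show ?thesis using \<eta> by blast
qed

end

section \<open>Bounded local intersections imply expansivity\<close>

lemma finite_uniform_pos:
  fixes P :: "'i \<Rightarrow> real \<Rightarrow> bool"
  assumes "finite I" and "\<And>i. i \<in> I \<Longrightarrow> \<exists>d>0. P i d"
    and mono: "\<And>i d e. P i d \<Longrightarrow> 0 < e \<Longrightarrow> e \<le> d \<Longrightarrow> P i e"
  shows "\<exists>d>0. \<forall>i\<in>I. P i d"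
  using assms(1,2)
proof (induction I rule: finite_induct)
  case empty
  show ?case by (intro exI[of _ 1]) simp
next
  case (insert i I)
  obtain d e where "0 < d" "\<forall>i\<in>I. P i d" "0 < e" "P i e"
    using insert by (metis insertCI)
  then show ?case
    by (intro exI[of _ "min d e"]) (auto intro: mono)
qed

context section_system
begin

text \<open>A compact set inside an open set has a uniform margin; finitely many margins have a
  common lower bound.\<close>

lemma Dset_neighbourhood:
  assumes "\<And>i. i \<in> {1..k} \<Longrightarrow> T i \<subseteq> interior (Dset X \<kappa> (S i))"
  shows "\<exists>d>0. \<forall>i\<in>{1..k}. \<forall>p\<in>T i. \<forall>q. dist p q < d \<longrightarrow> q \<in> Dset X \<kappa> (S i)"
proof (rule finite_uniform_pos)
  fix i assume i: "i \<in> {1..k}"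
  have "compact (T i)"
    using adequate i unfolding adequate_pair_def cross_section_def by auto
  then obtain d where "0 < d" "(\<Union>p\<in>T i. ball p d) \<subseteq> interior (Dset X \<kappa> (S i))"
    using compact_subset_open_imp_ball_epsilon_subset[OF _ open_interior assms[OF i]] by blast
  then show "\<exists>d>0. \<forall>p\<in>T i. \<forall>q. dist p q < d \<longrightarrow> q \<in> Dset X \<kappa> (S i)"
    using interior_subset by (intro exI[of _ d]) (auto simp: subset_iff)
qed auto

lemma card_le_imp_N_expansive:
  assumes regular: "\<And>\<kappa> i. 0 < \<kappa> \<Longrightarrow> i \<in> {1..k} \<Longrightarrow> T i \<subseteq> interior (Dset X \<kappa> (S i))"
    and \<eta>: "0 < \<eta>" "\<eta> < \<epsilon>0"
    and bound: "\<And>i x. i \<in> {1..k} \<Longrightarrow> x \<in> T i \<Longrightarrow> finite (W \<epsilon>0 \<eta> i x) \<and> card (W \<epsilon>0 \<eta> i x) \<le> N"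
  shows "N_expansive X N"
  unfolding N_expansive_def
proof (intro allI impI)
  fix e :: real assume "0 < e"
  have "0 < \<eta> / 2" using \<eta> by simp
  from uniform_flow_id[OF this] obtain \<kappa>1 where \<kappa>1: "0 < \<kappa>1"
    "\<And>t x. \<bar>t\<bar> < \<kappa>1 \<Longrightarrow> dist (X t x) x < \<eta> / 2" by metis
  \<comment> \<open>A chain correction will be a sum of three terms below \<open>\<kappa>\<close>,
    hence \<open>\<rho> / 4\<close>; the final time difference has four, hence \<open>e / 5\<close>.
    The bound \<open>\<kappa>1\<close> keeps projections within \<open>\<eta> / 2\<close>.\<close>
  define \<kappa> where "\<kappa> = min \<kappa>1 (min (\<rho> / 4) (e / 5))"
  have \<kappa>: "0 < \<kappa>" "\<kappa> \<le> \<kappa>1" "4 * \<kappa> \<le> \<rho>" "5 * \<kappa> \<le> e"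
    using \<kappa>1 rho_pos \<open>0 < e\<close> by (auto simp: \<kappa>_def min_def)
  let ?R = "\<theta> + \<epsilon>"
  have per: "X s w \<noteq> w" if "0 < s" "s \<le> \<kappa>" for s w
    using no_small_period[of s w] that \<kappa> rho_less rho_pos by linarith
  obtain \<delta>1 where \<delta>1: "0 < \<delta>1" "\<And>p z g s. \<bar>g\<bar> \<le> ?R \<Longrightarrow> \<bar>s\<bar> \<le> \<kappa> \<Longrightarrow> dist p z < \<delta>1 \<Longrightarrow>
      dist (X g p) (X (g + s) z) < \<delta>1 \<Longrightarrow> \<bar>s\<bar> < \<kappa>"
    using small_shift[of \<kappa> \<kappa> ?R] per \<kappa>(1) by metis
  obtain \<delta>2 where \<delta>2: "0 < \<delta>2"
    "\<And>i p q. i \<in> {1..k} \<Longrightarrow> p \<in> T i \<Longrightarrow> dist p q < \<delta>2 \<Longrightarrow> q \<in> Dset X \<kappa> (S i)"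
    using Dset_neighbourhood[OF regular[OF \<kappa>(1)]] by blast
  \<comment> \<open>Here \<open>\<delta>1\<close> controls the lag, \<open>\<delta>2\<close> makes
    the points projectable, and \<open>\<eta> / 2\<close> is the share of \<open>\<eta>\<close> left
    by the projection.\<close>
  define d where "d = min \<delta>1 (min \<delta>2 (\<eta> / 2))"
  have d: "0 < d" "d \<le> \<delta>1" "d \<le> \<delta>2" "d \<le> \<eta> / 2"
    using \<delta>1(1) \<delta>2(1) \<eta> by (auto simp: d_def)
  have "\<exists>B\<subseteq>A. finite B \<and> card B < N + 1 \<and> A \<subseteq> flow_image X {-e<..<e} B"
    if \<alpha>: "\<alpha> \<in> reparams A" and diam: "\<forall>t. diameter (reparam_image X \<alpha> t A) < d" for A \<alpha>
  proof -
    obtain x0 where x0: "x0 \<in> A" "\<alpha> x0 = id" using \<alpha> unfolding reparams_def by blast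
    have close: "dist (X t x0) (X (\<alpha> y t) y) < d" if "y \<in> A" for y t
    proof -
      have "X (\<alpha> x0 t) x0 \<in> reparam_image X \<alpha> t A" "X (\<alpha> y t) y \<in> reparam_image X \<alpha> t A"
        using that x0 unfolding reparam_image_def by blast+
      then have "dist (X (\<alpha> x0 t) x0) (X (\<alpha> y t) y) \<le> diameter (reparam_image X \<alpha> t A)"
        by (intro diameter_bounded_bound bounded_all)
      also have "\<dots> < d" using diam by blast
      finally show ?thesis using x0(2) by simp
    qed
    \<comment> \<open>By the intermediate value theorem the time lag cannot leave the small range to which
      \<open>small_shift\<close> confines it; the reparametrisations need not be increasing for this.\<close>
    have shift: "\<bar>\<alpha> y (u + g) - \<alpha> y u - g\<bar> < \<kappa>" if y: "y \<in> A" and g: "0 \<le> g" "g \<le> ?R" for y u g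
    proof (rule ccontr)
      assume not: "\<not> \<bar>\<alpha> y (u + g) - \<alpha> y u - g\<bar> < \<kappa>"
      have "continuous_on UNIV (\<alpha> y)"
        using \<alpha> y unfolding reparams_def Hom0_def homeomorphism_def by blast
      then have "continuous_on {0..g} (\<lambda>v. \<alpha> y (u + v))"
        by (rule continuous_on_compose2) (auto intro: continuous_on_add continuous_on_const continuous_on_id)
      then have "continuous_on {0..g} (\<lambda>v. \<bar>\<alpha> y (u + v) - \<alpha> y u - v\<bar>)"
        by (intro continuous_on_rabs continuous_on_diff continuous_on_const continuous_on_id)
      then obtain v where v: "0 \<le> v" "v \<le> g" "\<bar>\<alpha> y (u + v) - \<alpha> y u - v\<bar> = \<kappa>"
        using IVT'[of "\<lambda>v. \<bar>\<alpha> y (u + v) - \<alpha> y u - v\<bar>" 0 \<kappa> g] not g \<kappa>(1) by auto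
      let ?s = "\<alpha> y (u + v) - \<alpha> y u - v"
      have "\<bar>?s\<bar> < \<kappa>"
      proof (rule \<delta>1(2))
        show "dist (X u x0) (X (\<alpha> y u) y) < \<delta>1" using close[OF y, of u] d by simp
        show "dist (X v (X u x0)) (X (v + ?s) (X (\<alpha> y u) y)) < \<delta>1"
          using close[OF y, of "u + v"] d by (simp add: flow_flow add.commute)
      qed (use v g in auto)
      then show False using v(3) by simp
    qed
    \<comment> \<open>The base point \<open>x0\<close> may lie off the sections. Moving it by
      \<open>s\<close> makes \<open>s + G j\<close> the visiting times along its orbit.\<close>
    obtain s where s: "0 \<le> s" "s \<le> \<epsilon>" "X s x0 \<in> TT" using hits_forward by blast
    define x where "x = X s x0"
    have x: "x \<in> TT" using s(3) by (simp only: x_def)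
    obtain G where G: "G 0 = 0" "\<And>j. G (j + 1) = G j + ret_time (orb j x)" "\<And>j. orb j x = X (G j) x"
      using orbit_times[OF x] by blast
    have orb_x: "orb j x = X (s + G j) x0" for j
      using G(3)[of j] by (simp only: x_def flow_flow add.commute)
    have "\<forall>j. \<exists>l. l \<in> {1..k} \<and> orb j x \<in> T l"
      using return_iter_in[OF x] by blast
    then obtain l where l: "\<And>j. l j \<in> {1..k}" "\<And>j. orb j x \<in> T (l j)" by metis
    have "\<exists>\<sigma>. \<forall>j. \<bar>\<sigma> j\<bar> < \<kappa> \<and> X (\<sigma> j) (X (\<alpha> y (s + G j)) y) \<in> S (l j)" if y: "y \<in> A" for y
    proof -
      have "\<exists>r. \<bar>r\<bar> < \<kappa> \<and> X r (X (\<alpha> y (s + G j)) y) \<in> S (l j)" for j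
      proof -
        have "dist (orb j x) (X (\<alpha> y (s + G j)) y) < \<delta>2"
          using close[OF y, of "s + G j"] d unfolding orb_x by simp
        then have "X (\<alpha> y (s + G j)) y \<in> Dset X \<kappa> (S (l j))"
          using \<delta>2(2) l by blast
        then show ?thesis by (rule DsetE) blast
      qed
      then show ?thesis by metis
    qed
    then obtain \<sigma> where \<sigma>: "\<And>y j. y \<in> A \<Longrightarrow> \<bar>\<sigma> y j\<bar> < \<kappa>"
      "\<And>y j. y \<in> A \<Longrightarrow> X (\<sigma> y j) (X (\<alpha> y (s + G j)) y) \<in> S (l j)"
      by metis
    define z where "z y j = X (\<sigma> y j) (X (\<alpha> y (s + G j)) y)" for y j
    have zW: "z y 0 \<in> W \<epsilon>0 \<eta> (l 0) x" if y: "y \<in> A" for y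
    proof (rule chain_in_stable_unstable[OF x])
      show "z y 0 \<in> S (l 0)" using \<sigma>(2)[OF y] by (simp add: z_def)
      show "dist (orb j x) (z y j) < \<eta>" for j
      proof -
        have "dist (orb j x) (X (\<alpha> y (s + G j)) y) < \<eta> / 2"
          using close[OF y, of "s + G j"] d unfolding orb_x by simp
        moreover have "dist (z y j) (X (\<alpha> y (s + G j)) y) < \<eta> / 2"
          unfolding z_def by (rule \<kappa>1(2)) (use \<sigma>(1)[OF y, of j] \<kappa> in simp)
        ultimately show ?thesis
          using dist_triangle2[of "orb j x" "z y j" "X (\<alpha> y (s + G j)) y"] by simp
      qed
      show "chain x (z y)"
        unfolding chain_def
      proof (intro allI conjI)
        fix j
        show "\<exists>l\<in>{1..k}. orb j x \<in> T l \<and> z y j \<in> S l"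
          using l \<sigma>(2)[OF y] unfolding z_def by blast
        let ?g = "ret_time (orb j x)" and ?t = "\<alpha> y (s + G j)" and ?t' = "\<alpha> y (s + G (j + 1))"
        \<comment> \<open>The lag over one return, corrected by the projections at its two
          ends.\<close>
        let ?r = "\<sigma> y (j + 1) + (?t' - ?t - ?g) - \<sigma> y j"
        have o: "orb j x \<in> TT" by (rule return_iter_in[OF x])
        have g: "0 \<le> ?g" "?g \<le> ?R" using ret_time_pos[OF o] ret_time_le[OF o] by auto
        have sG: "s + G (j + 1) = (s + G j) + ?g" using G(2)[of j] by simp
        have "\<bar>?t' - ?t - ?g\<bar> < \<kappa>"
          using shift[OF y g, of "s + G j"] unfolding sG .
        then have "\<bar>?r\<bar> < \<rho>"
          using \<sigma>(1)[OF y, of j] \<sigma>(1)[OF y, of "j + 1"] \<kappa> by linarith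
        moreover have "z y (j + 1) = X (?g + ?r) (z y j)"
          unfolding z_def flow_flow by (simp add: algebra_simps)
        ultimately show "\<exists>r. \<bar>r\<bar> < \<rho> \<and> z y (j + 1) = X (?g + r) (z y j)" by blast
      qed
    qed (rule \<eta>(2))
    let ?\<pi> = "\<lambda>y. z y 0"
    have sub: "?\<pi> ` A \<subseteq> W \<epsilon>0 \<eta> (l 0) x" using zW by blast
    have "x \<in> T (l 0)" using l(2)[of 0] x by simp
    then have fin: "finite (W \<epsilon>0 \<eta> (l 0) x)" "card (W \<epsilon>0 \<eta> (l 0) x) \<le> N"
      using bound[OF l(1)] by blast+
    \<comment> \<open>One representative per fibre of the projection: \<open>A\<close> may be
      infinite, while its image is bounded by the local intersection.\<close>
    define B where "B = inv_into A ?\<pi> ` ?\<pi> ` A"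
    have img: "finite (?\<pi> ` A)" "card (?\<pi> ` A) \<le> N"
      using finite_subset[OF sub fin(1)] order_trans[OF card_mono[OF fin(1) sub] fin(2)] .
    have "finite B" "card B \<le> N"
      unfolding B_def using finite_imageI[OF img(1)] order_trans[OF card_image_le[OF img(1)] img(2)] .
    moreover have "B \<subseteq> A" unfolding B_def by (auto intro: inv_into_into)
    moreover have "A \<subseteq> flow_image X {-e<..<e} B"
    proof
      fix y assume y: "y \<in> A"
      define b where "b = inv_into A ?\<pi> (?\<pi> y)"
      have b: "b \<in> B" "b \<in> A" "z b 0 = z y 0"
        using y f_inv_into_f[of "?\<pi> y" ?\<pi> A] inv_into_into[of "?\<pi> y" ?\<pi> A] unfolding B_def b_def by auto
      \<comment> \<open>Both reparametrised times are within \<open>\<kappa>\<close> of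
        \<open>s\<close>, so their difference is small.\<close>
      let ?c = "\<sigma> b 0 + \<alpha> b s - \<alpha> y s - \<sigma> y 0"
      have "y = X (- (\<sigma> y 0 + \<alpha> y s)) (z y 0)"
        unfolding z_def by (simp add: G(1) flow_flow)
      also have "\<dots> = X ?c b"
        unfolding b(3)[symmetric] unfolding z_def by (simp add: G(1) flow_flow algebra_simps)
      finally have "y = X ?c b" .
      moreover have \<alpha>s: "\<bar>\<alpha> w s - s\<bar> < \<kappa>" if w: "w \<in> A" for w
      proof -
        have "\<alpha> w 0 = 0" using \<alpha> w unfolding reparams_def Hom0_def by blast
        then show ?thesis using shift[OF w, of s 0] s theta_pos by simp
      qed
      have "\<bar>?c\<bar> < e"
        using \<sigma>(1)[OF y, of 0] \<sigma>(1)[OF b(2), of 0] \<alpha>s[OF y] \<alpha>s[OF b(2)] \<kappa>(1,4) by linarith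
      then have "?c \<in> {-e<..<e}" by (simp add: abs_less_iff)
      ultimately show "y \<in> flow_image X {-e<..<e} B"
        unfolding flow_image_def using b(1) by blast
    qed
    ultimately show ?thesis by (intro exI[of _ B]) auto
  qed
  then show "\<exists>d>0. \<forall>A. \<forall>\<alpha>\<in>reparams A. (\<forall>t. diameter (reparam_image X \<alpha> t A) < d) \<longrightarrow>
      (\<exists>B\<subseteq>A. finite B \<and> card B < N + 1 \<and> A \<subseteq> flow_image X {-e<..<e} B)"
    using d(1) by blast
qed

text \<open>Times are confined to \<open>3 * \<delta>'\<close>, however large, so uniform continuity
  reduces the condition to neighbourhoods of the \<open>T i\<close>.\<close>

lemma eps0_exists:
  assumes "T_nbhd": "\<And>i. i \<in> {1..k} \<Longrightarrow> T i \<subseteq> interior (Dset X \<rho> (S i))"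
  shows "\<exists>\<epsilon>0. eps0_ok X \<delta>' k S T \<rho> \<epsilon>0"
proof -
  obtain d where d: "0 < d"
    "\<And>i p q. i \<in> {1..k} \<Longrightarrow> p \<in> T i \<Longrightarrow> dist p q < d \<Longrightarrow> q \<in> Dset X \<rho> (S i)"
    using Dset_neighbourhood[OF T_nbhd] by blast
  obtain c where c: "0 < c" "\<And>s t x y. \<bar>s\<bar> \<le> 3 * \<delta>' \<Longrightarrow> \<bar>t\<bar> \<le> 3 * \<delta>' \<Longrightarrow> \<bar>s - t\<bar> < c \<Longrightarrow> dist x y < c
      \<Longrightarrow> dist (X s x) (X t y) < d"
    using uniform_flow[OF d(1), of "3 * \<delta>'"] by metis
  define \<epsilon>0 where "\<epsilon>0 = min c (\<theta> / 3)"
  have "0 < \<epsilon>0" "\<epsilon>0 < \<theta> / 2" "\<epsilon>0 \<le> c" using c(1) theta_pos by (auto simp: \<epsilon>0_def min_def)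
  moreover have "X t y \<in> Dset X \<rho> (S j)"
    if "j \<in> {1..k}" "dist x y < \<epsilon>0" "\<bar>t\<bar> < 3 * \<delta>'" "X t x \<in> T j" for j x y t
    using d(2)[OF that(1,4)] c(2)[of t t x y] c(1) that \<open>\<epsilon>0 \<le> c\<close> by simp
  ultimately show ?thesis unfolding eps0_ok_def by blast
qed

end

section \<open>Existence of adequate pairs\<close>

lemma inj_choice_infinite:
  assumes "finite Z" "\<And>z. z \<in> Z \<Longrightarrow> infinite (J z)"
  shows "\<exists>v. inj_on v Z \<and> (\<forall>z\<in>Z. v z \<in> J z)"
  using assms
proof (induction Z rule: finite_induct)
  case (insert z Z)
  then obtain v where v: "inj_on v Z" "\<forall>z\<in>Z. v z \<in> J z" by auto
  have "infinite (J z - v ` Z)" using insert by simp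
  then obtain c where c: "c \<in> J z" "c \<notin> v ` Z" by (metis Diff_iff finite.emptyI ex_in_conv)
  have "v(z := c) ` Z = v ` Z" using insert(2) by (auto simp: fun_upd_image)
  moreover have "inj_on (v(z := c)) Z" using v(1) insert(2) by (simp add: inj_on_def fun_upd_def)
  ultimately show ?case
    using v c insert(2) by (intro exI[of _ "v(z := c)"]) (auto simp: inj_on_def)
qed simp

section \<open>Functions increasing along the flow and their level sets\<close>

context compact_flow
begin

text \<open>Only the start of the arc must lie in \<open>V\<close>. Hence a level set inside
  \<open>V\<close> is not revisited within \<open>\<epsilon>\<close> even by an arc that leaves
  \<open>V\<close> and comes back.\<close>

definition rises :: "real \<Rightarrow> ('a \<Rightarrow> real) \<Rightarrow> 'a set \<Rightarrow> bool" where
  "rises \<epsilon> f V \<longleftrightarrow> continuous_on UNIV f \<and> open V \<and> (\<forall>q\<in>V. \<forall>t. 0 < t \<longrightarrow> t \<le> \<epsilon> \<longrightarrow> f q < f (X t q))"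

text \<open>Whitney's function: the derivative of \<open>\<integral>\<^sub>0\<^sup>c dist p (X s q) ds\<close> along the flow is
  \<open>dist p (X c q) - dist p q\<close>, which is positive near \<open>q = p\<close>.\<close>

lemma rises_exists:
  assumes "X c p \<noteq> p" "0 < c"
  obtains f V a where "0 < a" "p \<in> V" "rises a f V"
proof -
  define f where "f q = integral {0..c} (\<lambda>s. dist p (X s q))" for q
  define D where "D q = dist p (X c q) - dist p q" for q
  have cont_orbit: "continuous_on A (\<lambda>s. dist p (X s q))" for A q
    by (intro continuous_on_dist continuous_on_const continuous_on_flow continuous_on_id)
  have "continuous_on UNIV D"
    unfolding D_def by (intro continuous_on_diff continuous_on_dist continuous_on_const continuous_on_flow continuous_on_id)
  then have "open (D -` {0<..})" by (intro open_vimage) auto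
  moreover have "p \<in> D -` {0<..}" using assms by (simp add: D_def dist_commute)
  ultimately obtain r where r: "0 < r" "ball p r \<subseteq> D -` {0<..}"
    using open_contains_ball by blast
  then have "0 < r / 2" by simp
  from uniform_flow_id[OF this] obtain \<kappa> where \<kappa>: "0 < \<kappa>" "\<And>t x. \<bar>t\<bar> < \<kappa> \<Longrightarrow> dist (X t x) x < r / 2" by metis
  have "continuous_on (UNIV \<times> cbox 0 c) (\<lambda>(q, s). dist p (X s q))"
    unfolding case_prod_beta
    by (intro continuous_on_dist continuous_on_const continuous_on_flow continuous_on_fst continuous_on_snd continuous_on_id)
  then have cont: "continuous_on UNIV f"
    unfolding f_def using integral_continuous_on_param[of UNIV 0 c] by simp
  have "f q < f (X t q)" if q: "q \<in> ball p (r / 2)" and t: "0 < t" "t \<le> \<kappa> / 2" for q t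
  proof -
    let ?g = "\<lambda>s. dist p (X s q)"
    have int: "?g integrable_on {a..b}" for a b :: real
      by (intro integrable_continuous_real cont_orbit)
    \<comment> \<open>The flow slides the window of integration; comparing both windows inside
      \<open>{0..t + c}\<close> leaves \<open>{c..t + c}\<close> minus
      \<open>{0..t}\<close>.\<close>
    have f_flow: "f (X t q) = integral {t..t + c} ?g"
    proof -
      have "f (X t q) = integral {0..c} (?g \<circ> (+) t)"
        unfolding f_def comp_def flow_flow by (simp only: add.commute)
      then show ?thesis unfolding integral_shift_Icc_real by (simp add: add.commute)
    qed
    have gc: "?g \<circ> (+) c = (\<lambda>s. dist p (X c (X s q)))"
      by (simp add: comp_def flow_flow)
    have end_part: "integral {c..t + c} ?g = integral {0..t} (\<lambda>s. dist p (X c (X s q)))"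
      using integral_shift_Icc_real[of 0 t ?g c] unfolding gc by simp
    have contD: "continuous_on {0..t} (\<lambda>s. D (X s q))"
      unfolding D_def by (intro continuous_on_diff continuous_on_dist continuous_on_const continuous_on_flow continuous_on_id)
    have Dpos: "0 < D (X s q)" if "s \<in> {0..t}" for s
    proof -
      have "dist (X s q) q < r / 2" using \<kappa> that t by (intro \<kappa>(2)) auto
      then have "X s q \<in> ball p r"
        using q dist_triangle2[of p "X s q" q] by (simp add: dist_commute)
      then show ?thesis using r(2) by blast
    qed
    \<comment> \<open>A positive minimum of \<open>D\<close> along the arc makes its integral
      strictly positive.\<close>
    obtain m where m: "0 < m" "\<And>s. s \<in> {0..t} \<Longrightarrow> m \<le> D (X s q)"
    proof -
      have "{0..t} \<noteq> {}" using t by simp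
      from continuous_attains_inf[OF compact_Icc this contD] show ?thesis
        using that Dpos by blast
    qed
    have "0 < m * t" using m t by simp
    also have "\<dots> = integral {0..t} (\<lambda>s. m)" using t by simp
    also have "\<dots> \<le> integral {0..t} (\<lambda>s. D (X s q))"
      using m contD by (intro integral_le integrable_continuous_real continuous_on_const) auto
    also have "\<dots> = integral {0..t} (\<lambda>s. dist p (X c (X s q))) - integral {0..t} ?g"
      unfolding D_def
      by (intro Henstock_Kurzweil_Integration.integral_diff integrable_continuous_real continuous_on_dist
          continuous_on_const continuous_on_flow continuous_on_id)
    also have "\<dots> = integral {c..t + c} ?g - integral {0..t} ?g" by (simp only: end_part)
    also have "\<dots> = f (X t q) - f q"
      unfolding f_flow
      using Henstock_Kurzweil_Integration.integral_combine[of 0 c "t + c" ?g]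
        Henstock_Kurzweil_Integration.integral_combine[of 0 t "t + c" ?g] int t assms(2)
      by (simp add: f_def)
    finally show ?thesis by simp
  qed
  then have "rises (\<kappa> / 2) f (ball p (r / 2))"
    unfolding rises_def using cont by blast
  then show ?thesis using that[of "\<kappa> / 2" "ball p (r / 2)" f] \<kappa> r by simp
qed

text \<open>The values of \<open>f\<close> at times \<open>- \<kappa>\<close> and
  \<open>\<kappa>\<close> lie on either side of \<open>f x\<close>. This persists for nearby points
  and levels, and the intermediate value theorem gives the crossing.\<close>

lemma local_crossing:
  assumes "rises \<epsilon> f V" "0 < \<epsilon>" "x \<in> V" "0 < e"
  obtains d where "0 < d" "\<And>q v. dist x q < d \<Longrightarrow> \<bar>v - f x\<bar> < d \<Longrightarrow>
    \<exists>t. \<bar>t\<bar> < e \<and> f (X t q) = v \<and> dist x (X t q) < e"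
proof -
  have f: "continuous_on UNIV f" "open V" "\<And>q t. q \<in> V \<Longrightarrow> 0 < t \<Longrightarrow> t \<le> \<epsilon> \<Longrightarrow> f q < f (X t q)"
    using assms(1) unfolding rises_def by auto
  obtain r where r: "0 < r" "ball x r \<subseteq> V" using f(2) assms(3) open_contains_ball by blast
  let ?e = "min e r / 2"
  have "0 < ?e" using r assms by simp
  from uniform_flow_id[OF this] obtain \<kappa>1 where \<kappa>1: "0 < \<kappa>1" "\<And>t x. \<bar>t\<bar> < \<kappa>1 \<Longrightarrow> dist (X t x) x < ?e" by metis
  define \<kappa> where "\<kappa> = min (min \<kappa>1 e / 2) \<epsilon>"
  have \<kappa>: "0 < \<kappa>" "\<kappa> < \<kappa>1" "\<kappa> < e" "\<kappa> \<le> \<epsilon>" using \<kappa>1(1) assms by (auto simp: \<kappa>_def min_def)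
  \<comment> \<open>The lower value is obtained by starting from \<open>X (- \<kappa>) x\<close>,
    which must therefore be in \<open>V\<close>.\<close>
  have "dist (X (- \<kappa>) x) x < r" using \<kappa>1(2)[of "-\<kappa>" x] \<kappa> r by simp
  then have "X (- \<kappa>) x \<in> V" using r(2) by (auto simp: dist_commute)
  from f(3)[OF this \<kappa>(1,4)] have lo: "f (X (- \<kappa>) x) < f x" by simp
  have hi: "f x < f (X \<kappa> x)" using f(3)[OF assms(3) \<kappa>(1,4)] .
  \<comment> \<open>Half of the smaller gap: one half absorbs the change of point, the other the
    change of level.\<close>
  define c where "c = min (f x - f (X (- \<kappa>) x)) (f (X \<kappa> x) - f x) / 2"
  have c: "0 < c" "f (X (- \<kappa>) x) + 2 * c \<le> f x" "f x + 2 * c \<le> f (X \<kappa> x)"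
    using lo hi by (auto simp: c_def min_def)
  have cont: "continuous_on UNIV (\<lambda>q. f (X t q))" for t
    by (rule continuous_on_compose2[OF f(1)]) (auto intro: continuous_on_flow continuous_on_const continuous_on_id)
  have "\<exists>d>0. \<forall>q. dist q x < d \<longrightarrow> dist (f (X t q)) (f (X t x)) < c" for t
    using cont[of t] c(1) unfolding continuous_on_iff by blast
  then obtain d1 d2 where d: "0 < d1" "\<And>q. dist q x < d1 \<Longrightarrow> \<bar>f (X \<kappa> q) - f (X \<kappa> x)\<bar> < c"
    "0 < d2" "\<And>q. dist q x < d2 \<Longrightarrow> \<bar>f (X (- \<kappa>) q) - f (X (- \<kappa>) x)\<bar> < c"
    unfolding dist_real_def by metis
  show ?thesis
  proof (rule that[of "min (min d1 d2) (min c ?e)"])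
    show "0 < min (min d1 d2) (min c ?e)" using d c \<open>0 < ?e\<close> by simp
    fix q v assume *: "dist x q < min (min d1 d2) (min c ?e)" "\<bar>v - f x\<bar> < min (min d1 d2) (min c ?e)"
    then have "\<bar>f (X \<kappa> q) - f (X \<kappa> x)\<bar> < c" "\<bar>f (X (- \<kappa>) q) - f (X (- \<kappa>) x)\<bar> < c" "\<bar>v - f x\<bar> < c"
      using d(2,4)[of q] by (simp_all add: dist_commute)
    then have "f (X (- \<kappa>) q) \<le> v" "v \<le> f (X \<kappa> q)" using c(2,3) by linarith+
    moreover have "continuous_on {- \<kappa>..\<kappa>} (\<lambda>t. f (X t q))"
      by (rule continuous_on_compose2[OF f(1)]) (auto intro: continuous_on_flow continuous_on_const continuous_on_id)
    ultimately obtain t where t: "- \<kappa> \<le> t" "t \<le> \<kappa>" "f (X t q) = v"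
      using IVT'[of "\<lambda>t. f (X t q)" "- \<kappa>" v \<kappa>] \<kappa>(1) by auto
    have "dist (X t q) q < ?e" using \<kappa>1(2)[of t q] t \<kappa> by linarith
    then have "dist x (X t q) < e" using * dist_triangle2[of x "X t q" q] by simp
    then show "\<exists>t. \<bar>t\<bar> < e \<and> f (X t q) = v \<and> dist x (X t q) < e"
      using t \<kappa> by (intro exI[of _ t]) auto
  qed
qed

text \<open>The interior condition holds at every time scale, which is stronger than
  \<open>section_interior\<close> at \<open>\<epsilon>\<close>. Excluding forward returns also
  excludes backward ones, by exchanging the two points.\<close>

definition good_section :: "real \<Rightarrow> 'a set \<times> 'a set \<Rightarrow> bool" where
  "good_section \<epsilon> = (\<lambda>(S, T). closed S \<and> closed T \<and> T \<subseteq> S \<and>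
     (\<forall>x\<in>S. \<forall>t. 0 < t \<longrightarrow> t \<le> \<epsilon> \<longrightarrow> X t x \<notin> S) \<and> (\<forall>\<kappa>>0. T \<subseteq> interior (Dset X \<kappa> S)))"

definition good_family :: "real \<Rightarrow> ('a set \<times> 'a set) set \<Rightarrow> bool" where
  "good_family \<epsilon> F \<longleftrightarrow> finite F \<and> (\<forall>p\<in>F. good_section \<epsilon> p) \<and>
     (\<forall>p\<in>F. \<forall>q\<in>F. p \<noteq> q \<longrightarrow> fst p \<inter> fst q = {})"

text \<open>The halved radius is a margin: crossings near a point of the inner ball stay in the
  outer ball, so they lie on the section itself and not merely on the level set.\<close>

lemma level_set_good:
  assumes rises: "rises \<epsilon> f V" and pos: "0 < \<epsilon>" and r: "0 < r" "cball c r \<subseteq> V"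
  shows "good_section \<epsilon> (cball c r \<inter> f -` {v}, cball c (r / 2) \<inter> f -` {v})"
proof -
  have f: "continuous_on UNIV f" "\<And>q t. q \<in> V \<Longrightarrow> 0 < t \<Longrightarrow> t \<le> \<epsilon> \<Longrightarrow> f q < f (X t q)"
    using rises unfolding rises_def by auto
  let ?S = "cball c r \<inter> f -` {v}" and ?T = "cball c (r / 2) \<inter> f -` {v}"
  have "closed (f -` {v})" using f(1) by (intro closed_vimage) auto
  then have "closed ?S" "closed ?T" by auto
  moreover have "?T \<subseteq> ?S" using r(1) by auto
  moreover have "X t x \<notin> ?S" if "x \<in> ?S" "0 < t" "t \<le> \<epsilon>" for x t
  proof -
    have "f x < f (X t x)" using f(2)[of x t] that r(2) by blast
    then show ?thesis using that(1) by auto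
  qed
  moreover have "?T \<subseteq> interior (Dset X \<kappa> ?S)" if "0 < \<kappa>" for \<kappa>
  proof
    fix x assume x: "x \<in> ?T"
    then have "x \<in> V" using r by auto
    moreover have "0 < min \<kappa> (r / 2)" using that r by simp
    ultimately obtain d where d: "0 < d" "\<And>q v. dist x q < d \<Longrightarrow> \<bar>v - f x\<bar> < d \<Longrightarrow>
      \<exists>t. \<bar>t\<bar> < min \<kappa> (r / 2) \<and> f (X t q) = v \<and> dist x (X t q) < min \<kappa> (r / 2)"
      using local_crossing[OF rises pos] by metis
    have "ball x d \<subseteq> Dset X \<kappa> ?S"
    proof
      fix q assume "q \<in> ball x d"
      then obtain t where t: "\<bar>t\<bar> < \<kappa>" "f (X t q) = v" "dist x (X t q) < r / 2"
        using d(2)[of q v] x d(1) by auto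
      then have "dist c (X t q) \<le> r" using x dist_triangle[of c "X t q" x] by simp
      then have "X t q \<in> ?S" using t by simp
      then show "q \<in> Dset X \<kappa> ?S" using t(1) by (rule DsetI)
    qed
    then show "x \<in> interior (Dset X \<kappa> ?S)" using d(1) by (auto simp: mem_interior)
  qed
  ultimately show ?thesis unfolding good_section_def by simp
qed

text \<open>New sections are small pieces of level sets. They avoid the old sections because an orbit
  meets these only at finitely many small times, and each other because the levels are distinct.\<close>

lemma good_family_extend:
  assumes pos: "0 < \<epsilon>" and F: "good_family \<epsilon> F" and rises: "rises \<epsilon> f V" and "compact K"
    and KV: "\<And>q t. q \<in> K \<Longrightarrow> 0 \<le> t \<Longrightarrow> t \<le> \<epsilon> \<Longrightarrow> X t q \<in> V"
  obtains F' where "good_family \<epsilon> F'" "F \<subseteq> F'" "\<And>q. q \<in> K \<Longrightarrow> \<exists>t\<in>{0..\<epsilon>}. \<exists>p\<in>F'. X t q \<in> snd p"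
proof -
  let ?\<Sigma> = "\<Union>p\<in>F. fst p"
  have f: "continuous_on UNIV f" "open V" using rises unfolding rises_def by auto
  have fin: "finite F" and closed_\<Sigma>: "closed ?\<Sigma>"
    using F unfolding good_family_def good_section_def by (auto intro!: closed_UN)
  \<comment> \<open>At time \<open>t\<close> the orbit of \<open>z\<close> is off the old sections;
    \<open>r\<close> is the radius of a new one and \<open>d\<close> the tolerance for points and
    levels. The bound \<open>min t (\<epsilon> - t)\<close> keeps the hitting time
    \<open>s + t\<close> in \<open>{0..\<epsilon>}\<close>.\<close>
  define Q where "Q z t r d \<longleftrightarrow> 0 < t \<and> t < \<epsilon> \<and> 0 < r \<and> cball (X t z) r \<subseteq> V - ?\<Sigma> \<and> 0 < d \<and>
      (\<forall>q v. dist (X t z) q < d \<longrightarrow> \<bar>v - f (X t z)\<bar> < d \<longrightarrow>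
        (\<exists>s. \<bar>s\<bar> < min t (\<epsilon> - t) \<and> f (X s q) = v \<and> dist (X t z) (X s q) < r / 2))" for z t r d
  have "\<exists>t r d. Q z t r d"
    if z: "z \<in> K" for z
  proof -
    have "finite {t \<in> {0<..<\<epsilon>}. X t z \<in> fst p}" if p: "p \<in> F" for p
    proof -
      have sec: "X t x \<notin> fst p" if "x \<in> fst p" "0 < t" "t \<le> \<epsilon>" for x t
        using F p that unfolding good_family_def good_section_def by (auto simp: case_prod_beta)
      have less: False if "s \<in> {0<..<\<epsilon>}" "t \<in> {0<..<\<epsilon>}" "X s z \<in> fst p" "X t z \<in> fst p" "s < t" for s t
        using sec[of "X s z" "t - s"] that by (simp add: flow_flow)
      show ?thesis
      proof (cases "{t \<in> {0<..<\<epsilon>}. X t z \<in> fst p} = {}")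
        case False
        then obtain s where s: "s \<in> {0<..<\<epsilon>}" "X s z \<in> fst p" by blast
        have "t = s" if "t \<in> {0<..<\<epsilon>}" "X t z \<in> fst p" for t
          using less[OF s(1) that(1) s(2) that(2)] less[OF that(1) s(1) that(2) s(2)]
          by (cases t s rule: linorder_cases) auto
        then have "{t \<in> {0<..<\<epsilon>}. X t z \<in> fst p} \<subseteq> {s}" by blast
        then show ?thesis by (rule finite_subset) simp
      qed (simp only: finite.emptyI)
    qed
    then have "finite (\<Union>p\<in>F. {t \<in> {0<..<\<epsilon>}. X t z \<in> fst p})" using fin by blast
    then have "{0<..<\<epsilon>} - (\<Union>p\<in>F. {t \<in> {0<..<\<epsilon>}. X t z \<in> fst p}) \<noteq> {}"
      using pos by (intro infinite_imp_nonempty Diff_infinite_finite) auto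
    then obtain t where t: "t \<in> {0<..<\<epsilon>}" "t \<notin> (\<Union>p\<in>F. {t \<in> {0<..<\<epsilon>}. X t z \<in> fst p})"
      by blast
    then have mem: "X t z \<in> V - ?\<Sigma>" using KV[OF z, of t] by auto
    moreover have "open (V - ?\<Sigma>)" using f(2) closed_\<Sigma> by (rule open_Diff)
    ultimately obtain r where r: "0 < r" "cball (X t z) r \<subseteq> V - ?\<Sigma>"
      by (meson open_contains_cball)
    have "0 < min (min t (\<epsilon> - t)) (r / 2)" using t(1) r(1) by simp
    then obtain d where d: "0 < d" "\<And>q v. dist (X t z) q < d \<Longrightarrow> \<bar>v - f (X t z)\<bar> < d \<Longrightarrow>
      \<exists>s. \<bar>s\<bar> < min (min t (\<epsilon> - t)) (r / 2) \<and> f (X s q) = v \<and> dist (X t z) (X s q) < min (min t (\<epsilon> - t)) (r / 2)"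
      using local_crossing[OF rises pos] mem by (metis DiffD1)
    have "Q z t r d"
      unfolding Q_def
    proof (intro conjI allI impI)
      fix q v assume *: "dist (X t z) q < d" "\<bar>v - f (X t z)\<bar> < d"
      from d(2)[OF this] obtain s where "\<bar>s\<bar> < min (min t (\<epsilon> - t)) (r / 2)" "f (X s q) = v"
        "dist (X t z) (X s q) < min (min t (\<epsilon> - t)) (r / 2)" by blast
      then show "\<exists>s. \<bar>s\<bar> < min t (\<epsilon> - t) \<and> f (X s q) = v \<and> dist (X t z) (X s q) < r / 2"
        by (intro exI[of _ s]) simp
    qed (use t(1) r d(1) in \<open>auto simp del: UN_iff\<close>)
    then show ?thesis by blast
  qed
  then obtain t r d where Q: "\<And>z. z \<in> K \<Longrightarrow> Q z (t z) (r z) (d z)" by metis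
  have trd: "\<And>z. z \<in> K \<Longrightarrow> 0 < t z" "\<And>z. z \<in> K \<Longrightarrow> t z < \<epsilon>" "\<And>z. z \<in> K \<Longrightarrow> 0 < r z"
    "\<And>z. z \<in> K \<Longrightarrow> cball (X (t z) z) (r z) \<subseteq> V - ?\<Sigma>" "\<And>z. z \<in> K \<Longrightarrow> 0 < d z"
    "\<And>z q v. z \<in> K \<Longrightarrow> dist (X (t z) z) q < d z \<Longrightarrow> \<bar>v - f (X (t z) z)\<bar> < d z \<Longrightarrow>
        \<exists>s. \<bar>s\<bar> < min (t z) (\<epsilon> - t z) \<and> f (X s q) = v \<and> dist (X (t z) z) (X s q) < r z / 2"
    using Q unfolding Q_def by blast+
  define U where "U z = X (t z) -` ball (X (t z) z) (d z)" for z
  have "open (U z)" for z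
    unfolding U_def by (intro open_vimage continuous_on_flow continuous_on_const continuous_on_id) auto
  moreover have "K \<subseteq> (\<Union>z\<in>K. U z)" using trd(5) by (force simp: U_def)
  ultimately obtain Z where Z: "Z \<subseteq> K" "finite Z" "K \<subseteq> (\<Union>z\<in>Z. U z)"
    using compactE_image[OF \<open>compact K\<close>, of K U] by blast
  \<comment> \<open>A whole interval of levels is usable. Distinct levels of the one function
    \<open>f\<close> separate new sections even where their balls overlap.\<close>
  have "infinite {f (X (t z) z) - d z<..<f (X (t z) z) + d z}" if "z \<in> Z" for z
    using trd(5)[of z] Z(1) that by (intro infinite_Ioo) auto
  then obtain v where v_in: "inj_on v Z" "\<forall>z\<in>Z. v z \<in> {f (X (t z) z) - d z<..<f (X (t z) z) + d z}"
    using inj_choice_infinite[OF Z(2), of "\<lambda>z. {f (X (t z) z) - d z<..<f (X (t z) z) + d z}"] by blast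
  then have v: "inj_on v Z" "\<And>z. z \<in> Z \<Longrightarrow> \<bar>v z - f (X (t z) z)\<bar> < d z"
    by (auto simp: abs_less_iff algebra_simps)
  define S where "S z = cball (X (t z) z) (r z) \<inter> f -` {v z}" for z
  define T where "T z = cball (X (t z) z) (r z / 2) \<inter> f -` {v z}" for z
  define F' where "F' = F \<union> (\<lambda>z. (S z, T z)) ` Z"
  have new: "good_section \<epsilon> (S z, T z)" if "z \<in> Z" for z
    unfolding S_def T_def using trd(3,4)[of z] that Z(1) by (intro level_set_good[OF rises pos]) auto
  have old_new: "fst p \<inter> S z = {}" if "p \<in> F" "z \<in> Z" for p z
    using trd(4)[of z] that Z(1) unfolding S_def by blast
  have new_new: "S z \<inter> S z' = {}" if "z \<in> Z" "z' \<in> Z" "z \<noteq> z'" for z z'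
    using inj_onD[OF v(1), of z z'] that unfolding S_def by auto
  have "good_family \<epsilon> F'"
    unfolding good_family_def
  proof (intro conjI ballI impI)
    show "finite F'" using fin Z(2) by (simp add: F'_def)
    show "good_section \<epsilon> p" if "p \<in> F'" for p
      using that new F unfolding F'_def good_family_def by blast
    fix p q assume pq: "p \<in> F'" "q \<in> F'" "p \<noteq> q"
    consider "p \<in> F" "q \<in> F" | z where "z \<in> Z" "q = (S z, T z)" "p \<in> F"
      | z where "z \<in> Z" "p = (S z, T z)" "q \<in> F"
      | z z' where "z \<in> Z" "z' \<in> Z" "p = (S z, T z)" "q = (S z', T z')"
      using pq(1,2) unfolding F'_def by blast
    then show "fst p \<inter> fst q = {}"
    proof cases
      case 1
      then show ?thesis using F pq(3) unfolding good_family_def by blast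
    next
      case 2
      then show ?thesis using old_new by simp
    next
      case 3
      then show ?thesis using old_new[of q z] by (simp add: Int_commute)
    next
      case 4
      then show ?thesis using new_new[of z z'] pq(3) by auto
    qed
  qed
  moreover have "\<exists>s\<in>{0..\<epsilon>}. \<exists>p\<in>F'. X s q \<in> snd p" if q: "q \<in> K" for q
  proof -
    obtain z where z: "z \<in> Z" "q \<in> U z" using Z(3) q by blast
    then obtain s where s: "\<bar>s\<bar> < min (t z) (\<epsilon> - t z)" "f (X s (X (t z) q)) = v z"
      "dist (X (t z) z) (X s (X (t z) q)) < r z / 2"
      using trd(6)[of z "X (t z) q" "v z"] v(2)[of z] Z(1) by (auto simp: U_def)
    then have "X (s + t z) q \<in> T z" by (simp add: T_def flow_flow)
    moreover have "s + t z \<in> {0..\<epsilon>}" using s(1) by auto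
    moreover have "(S z, T z) \<in> F'" using z by (simp add: F'_def)
    ultimately show ?thesis by (metis snd_conv)
  qed
  ultimately show ?thesis using that[of F'] by (simp add: F'_def)
qed

lemma good_family_finite_cover:
  assumes "0 < \<epsilon>" "finite P" "\<And>p. p \<in> P \<Longrightarrow> rises \<epsilon> (f p) (V p)" "\<And>p. p \<in> P \<Longrightarrow> compact (K p)"
    "\<And>p q t. p \<in> P \<Longrightarrow> q \<in> K p \<Longrightarrow> 0 \<le> t \<Longrightarrow> t \<le> \<epsilon> \<Longrightarrow> X t q \<in> V p"
  shows "\<exists>F. good_family \<epsilon> F \<and> (\<forall>q\<in>(\<Union>p\<in>P. K p). \<exists>t\<in>{0..\<epsilon>}. \<exists>S\<in>F. X t q \<in> snd S)"
  using assms(2-)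
proof (induction P rule: finite_induct)
  case empty
  show ?case by (intro exI[of _ "{}"]) (simp add: good_family_def)
next
  case (insert p P)
  then obtain F where F: "good_family \<epsilon> F" "\<forall>q\<in>(\<Union>p\<in>P. K p). \<exists>t\<in>{0..\<epsilon>}. \<exists>S\<in>F. X t q \<in> snd S"
    by auto
  obtain F' where F': "good_family \<epsilon> F'" "F \<subseteq> F'" "\<And>q. q \<in> K p \<Longrightarrow> \<exists>t\<in>{0..\<epsilon>}. \<exists>S\<in>F'. X t q \<in> snd S"
    using good_family_extend[OF assms(1) F(1) insert.prems(1,2), of p p] insert.prems(3) by blast
  have "\<exists>t\<in>{0..\<epsilon>}. \<exists>S\<in>F'. X t q \<in> snd S" if "q \<in> (\<Union>p\<in>insert p P. K p)" for q
  proof (cases "q \<in> K p")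
    case False
    then have "q \<in> (\<Union>p\<in>P. K p)" using that by blast
    then show ?thesis using F(2) F'(2) by blast
  qed (rule F'(3))
  then show ?case using F'(1) by blast
qed

lemma good_family_exists:
  assumes "\<forall>x. \<not> fixed_point X x"
  obtains \<epsilon> F where "0 < \<epsilon>" "good_family \<epsilon> F" "\<And>q. \<exists>t\<in>{0..\<epsilon>}. \<exists>p\<in>F. X t q \<in> snd p"
proof -
  define Q where "Q p f V b w \<longleftrightarrow> 0 < b \<and> rises b f V \<and> 0 < w \<and>
      (\<forall>q\<in>cball p w. \<forall>t. 0 \<le> t \<longrightarrow> t \<le> b \<longrightarrow> X t q \<in> V)" for p f V and b w :: real
  have "\<exists>f V b w. Q p f V b w" for p
  proof -
    obtain c0 where c0: "X c0 p \<noteq> p" using assms unfolding fixed_point_def by blast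
    have "\<exists>c>0. X c p \<noteq> p"
    proof (cases "0 < c0")
      case False
      have "c0 \<noteq> 0" using c0 by auto
      moreover have "X (- c0) p \<noteq> p" using c0 by (metis flow_inverse(2))
      ultimately show ?thesis using False by (intro exI[of _ "- c0"]) auto
    qed (use c0 in blast)
    then obtain f V a where fVa: "0 < a" "p \<in> V" "rises a f V" using rises_exists by metis
    then have "open V" unfolding rises_def by blast
    then obtain r where r: "0 < r" "ball p r \<subseteq> V" using fVa(2) open_contains_ball by blast
    then have "0 < r / 2" by simp
    from uniform_flow_id[OF this] obtain \<kappa> where \<kappa>: "0 < \<kappa>" "\<And>t x. \<bar>t\<bar> < \<kappa> \<Longrightarrow> dist (X t x) x < r / 2" by metis
    define b where "b = min a (\<kappa> / 2)"
    have b: "0 < b" "b \<le> a" "b < \<kappa>" using fVa(1) \<kappa>(1) by (auto simp: b_def min_def)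
    have "rises b f V" using fVa(3) b unfolding rises_def by force
    moreover have "X t q \<in> V" if "q \<in> cball p (r / 3)" "0 \<le> t" "t \<le> b" for q t
    proof -
      have "dist (X t q) q < r / 2" using \<kappa>(2)[of t q] that b by simp
      moreover have "dist p q \<le> r / 3" using that(1) by simp
      ultimately have "dist p (X t q) < r"
        using dist_triangle2[of p "X t q" q] r(1) by linarith
      then show ?thesis using r(2) by auto
    qed
    moreover have "0 < r / 3" using r(1) by simp
    ultimately have "Q p f V b (r / 3)" unfolding Q_def using b(1) by blast
    then show ?thesis by blast
  qed
  then obtain f V b w where "\<And>p. Q p (f p) (V p) (b p) (w p)" by metis
  then have fVbw: "\<And>p. 0 < b p" "\<And>p. rises (b p) (f p) (V p)" "\<And>p. 0 < w p"
    "\<And>p q t. q \<in> cball p (w p) \<Longrightarrow> 0 \<le> t \<Longrightarrow> t \<le> b p \<Longrightarrow> X t q \<in> V p"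
    unfolding Q_def by blast+
  have cover: "UNIV \<subseteq> (\<Union>p\<in>UNIV. ball p (w p))" using fVbw(3) by (meson UNIV_I UN_I centre_in_ball subsetI)
  obtain P where P: "finite P" "UNIV \<subseteq> (\<Union>p\<in>P. ball p (w p))"
    by (rule compactE_image[OF compact_UNIV _ cover]) auto
  then have ne: "P \<noteq> {}" by blast
  \<comment> \<open>All sections need a common time; \<open>rises\<close> and the containment in
    \<open>V p\<close> pass to smaller times.\<close>
  define \<epsilon> where "\<epsilon> = Min (b ` P)"
  have \<epsilon>: "0 < \<epsilon>" "\<And>p. p \<in> P \<Longrightarrow> \<epsilon> \<le> b p" using P(1) ne fVbw(1) by (auto simp: \<epsilon>_def)
  have "\<exists>F. good_family \<epsilon> F \<and> (\<forall>q\<in>(\<Union>p\<in>P. cball p (w p)). \<exists>t\<in>{0..\<epsilon>}. \<exists>S\<in>F. X t q \<in> snd S)"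
  proof (rule good_family_finite_cover[OF \<epsilon>(1) P(1)])
    show "rises \<epsilon> (f p) (V p)" if "p \<in> P" for p
      using fVbw(2)[of p] \<epsilon>(2)[OF that] unfolding rises_def by force
    show "X t q \<in> V p" if "p \<in> P" "q \<in> cball p (w p)" "0 \<le> t" "t \<le> \<epsilon>" for p q t
      using fVbw(4)[of q p t] \<epsilon>(2) that by fastforce
  qed auto
  then obtain F where F: "good_family \<epsilon> F"
    "\<And>q. q \<in> (\<Union>p\<in>P. cball p (w p)) \<Longrightarrow> \<exists>t\<in>{0..\<epsilon>}. \<exists>S\<in>F. X t q \<in> snd S" by blast
  have "q \<in> (\<Union>p\<in>P. cball p (w p))" for q
  proof -
    obtain p where "p \<in> P" "q \<in> ball p (w p)" using P(2) by blast
    then show ?thesis using ball_subset_cball by blast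
  qed
  with F(2) show ?thesis using that[OF \<epsilon>(1) F(1)] by blast
qed

text \<open>The chosen \<open>\<delta>\<close> is positive and bounds every diameter, so what
  remains to secure is \<open>\<theta> > 0\<close> and neighbourhoods at every time scale.\<close>

lemma adequate_pair_exists:
  assumes "\<forall>x. \<not> fixed_point X x"
  obtains \<epsilon> k S T \<rho> where "section_system X \<epsilon> (diameter (UNIV :: 'a set) + 1) k S T \<rho>"
    "\<And>\<kappa> i. 0 < \<kappa> \<Longrightarrow> i \<in> {1..k} \<Longrightarrow> T i \<subseteq> interior (Dset X \<kappa> (S i))"
proof -
  obtain \<epsilon> F where \<epsilon>: "0 < \<epsilon>" and F: "good_family \<epsilon> F" and hits: "\<And>q. \<exists>t\<in>{0..\<epsilon>}. \<exists>p\<in>F. X t q \<in> snd p"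
    using good_family_exists[OF assms] by blast
  define k where "k = card F"
  have "finite F" using F unfolding good_family_def by blast
  from ex_bij_betw_nat_finite_1[OF this] obtain h where h: "bij_betw h {1..k} F"
    unfolding k_def ..
  define S T where "S = fst \<circ> h" and "T = snd \<circ> h"
  have hF: "h i \<in> F" if "i \<in> {1..k}" for i using bij_betwE[OF h] that by blast
  have good: "closed (S i)" "closed (T i)" "T i \<subseteq> S i" "\<And>x t. x \<in> S i \<Longrightarrow> 0 < t \<Longrightarrow> t \<le> \<epsilon> \<Longrightarrow> X t x \<notin> S i"
    and reg: "\<And>\<kappa>. 0 < \<kappa> \<Longrightarrow> T i \<subseteq> interior (Dset X \<kappa> (S i))" if "i \<in> {1..k}" for i
    using F hF[OF that] unfolding good_family_def good_section_def S_def T_def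
    by (auto simp: case_prod_beta)
  have disj: "S i \<inter> S j = {}" if "i \<in> {1..k}" "j \<in> {1..k}" "i \<noteq> j" for i j
  proof -
    have "h i \<noteq> h j" using h that unfolding bij_betw_def inj_on_def by blast
    then show ?thesis using F hF that unfolding good_family_def S_def by simp
  qed
  have hitsT: "\<exists>t\<in>{0..\<epsilon>}. \<exists>i\<in>{1..k}. X t q \<in> T i" for q
  proof -
    obtain t p where "t \<in> {0..\<epsilon>}" "p \<in> F" "X t q \<in> snd p" using hits by blast
    moreover from \<open>p \<in> F\<close> obtain i where "i \<in> {1..k}" "p = h i" using h unfolding bij_betw_def by blast
    ultimately show ?thesis unfolding T_def comp_def by blast
  qed
  have cross: "cross_section X \<epsilon> R" if "closed R" "R \<subseteq> S i" "i \<in> {1..k}" for R i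
    unfolding cross_section_def
  proof (intro conjI ballI subset_antisym subsetI)
    fix x y assume x: "x \<in> R" and y: "y \<in> R \<inter> flow_image X {-\<epsilon><..<\<epsilon>} {x}"
    then obtain t where "t \<in> {-\<epsilon><..<\<epsilon>}" and y_eq: "y = X t x" unfolding flow_image_def by blast
    then have t: "\<bar>t\<bar> < \<epsilon>" "y = X t x" by (auto simp: abs_less_iff)
    have xy: "x \<in> S i" "X t x \<in> S i" using x y t(2) that(2) by auto
    have "\<not> 0 < t" using good(4)[OF that(3) xy(1), of t] xy(2) t(1) by auto
    moreover have "\<not> t < 0" using good(4)[OF that(3) xy(2), of "- t"] xy(1) t(1) by auto
    ultimately have "t = 0" by simp
    then show "y \<in> {x}" using t(2) by simp
  next
    fix x y assume "x \<in> R" "y \<in> {x}"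
    moreover have "x = X 0 x" by simp
    ultimately show "y \<in> R \<inter> flow_image X {-\<epsilon><..<\<epsilon>} {x}"
      using \<epsilon> unfolding flow_image_def by fastforce
  qed (rule that(1))
  have backward: "\<exists>i\<in>{1..k}. x \<in> flow_image X {-\<epsilon>..0} (T i)" for x
  proof -
    obtain t i where "t \<in> {0..\<epsilon>}" "i \<in> {1..k}" "X t x \<in> T i" using hitsT by blast
    moreover have "x = X (- t) (X t x)" by simp
    moreover have "- t \<in> {-\<epsilon>..0}" using \<open>t \<in> {0..\<epsilon>}\<close> by simp
    ultimately show ?thesis unfolding flow_image_def by blast
  qed
  have forward: "\<exists>i\<in>{1..k}. x \<in> flow_image X {0..\<epsilon>} (T i)" for x
  proof -
    \<comment> \<open>Hits are known in forward time, so the search starts \<open>\<epsilon>\<close>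
      before \<open>x\<close> and ends no later than \<open>x\<close>.\<close>
    obtain t i where "t \<in> {0..\<epsilon>}" "i \<in> {1..k}" "X t (X (- \<epsilon>) x) \<in> T i" using hitsT by blast
    moreover have "x = X (\<epsilon> - t) (X t (X (- \<epsilon>) x))" by (simp add: flow_flow)
    moreover have "\<epsilon> - t \<in> {0..\<epsilon>}" using \<open>t \<in> {0..\<epsilon>}\<close> by simp
    ultimately show ?thesis unfolding flow_image_def by blast
  qed
  have mono: "flow_image X I (T i) \<subseteq> flow_image X I (S i)" if "i \<in> {1..k}" for I i
    using good(3)[OF that] unfolding flow_image_def by blast
  have diam: "diameter A \<le> diameter (UNIV :: 'a set) + 1" for A :: "'a set"
    using diameter_subset[of A UNIV] by simp
  have adequate: "adequate_pair X \<epsilon> (diameter (UNIV :: 'a set) + 1) k S T"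
    unfolding adequate_pair_def
  proof (intro conjI ballI)
    fix i assume i: "i \<in> {1..k}"
    show "cross_section X \<epsilon> (S i)" "cross_section X \<epsilon> (T i)"
      using cross[OF good(1)[OF i] order_refl i] cross[OF good(2,3)[OF i] i] .
    show "T i \<subseteq> section_interior X \<epsilon> (S i)"
      using reg[OF i \<epsilon>] good(3)[OF i] unfolding section_interior_def Dset_def by blast
  next
    show "(\<Union>i\<in>{1..k}. flow_image X {0..\<epsilon>} (T i)) = UNIV" using forward by blast
    show "(\<Union>i\<in>{1..k}. flow_image X {-\<epsilon>..0} (T i)) = UNIV" using backward by blast
    show "(\<Union>i\<in>{1..k}. flow_image X {0..\<epsilon>} (S i)) = UNIV" using forward mono by blast
    show "(\<Union>i\<in>{1..k}. flow_image X {-\<epsilon>..0} (S i)) = UNIV" using backward mono by blast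
  qed (rule diam)+
  let ?SS = "\<Union>i\<in>{1..k}. S i"
  \<comment> \<open>This bounds \<open>\<theta>\<close> from below: a section excludes its own
    returns up to \<open>\<epsilon>\<close>, and the flow needs time to cross the positive distance
    between two disjoint compact sections.\<close>
  have "\<exists>r>0. \<forall>p\<in>{1..k} \<times> {1..k}. \<forall>x\<in>S (fst p). \<forall>t. 0 < t \<longrightarrow> t < r \<longrightarrow> X t x \<notin> S (snd p)"
  proof (rule finite_uniform_pos)
    fix p assume "p \<in> {1..k} \<times> {1..k}"
    then obtain i j where p: "p = (i, j)" "i \<in> {1..k}" "j \<in> {1..k}" by blast
    have "\<exists>d>0. \<forall>x\<in>S i. \<forall>t. 0 < t \<longrightarrow> t < d \<longrightarrow> X t x \<notin> S j"
    proof (cases "i = j")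
      case True
      then show ?thesis using good(4)[OF p(2)] \<epsilon> by (intro exI[of _ \<epsilon>]) auto
    next
      case False
      have "S i \<subseteq> - S j" using disj[OF p(2,3) False] by blast
      moreover have "compact (S i)" "open (- S j)" using good(1) p by auto
      ultimately obtain d where d: "0 < d" "(\<Union>x\<in>S i. ball x d) \<subseteq> - S j"
        using compact_subset_open_imp_ball_epsilon_subset by metis
      obtain \<kappa> where \<kappa>: "0 < \<kappa>" "\<And>t x. \<bar>t\<bar> < \<kappa> \<Longrightarrow> dist (X t x) x < d"
        using uniform_flow_id[OF d(1)] by metis
      have "X t x \<notin> S j" if "x \<in> S i" "0 < t" "t < \<kappa>" for x t
      proof -
        have "X t x \<in> ball x d" using \<kappa>(2)[of t x] that by (simp add: dist_commute)
        then show ?thesis using d(2) that(1) by blast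
      qed
      then show ?thesis using \<kappa>(1) by blast
    qed
    then show "\<exists>d>0. \<forall>x\<in>S (fst p). \<forall>t. 0 < t \<longrightarrow> t < d \<longrightarrow> X t x \<notin> S (snd p)" using p by simp
  qed auto
  then obtain r where r_pos: "0 < r" and no_return:
    "\<forall>p\<in>{1..k} \<times> {1..k}. \<forall>x\<in>S (fst p). \<forall>t. 0 < t \<longrightarrow> t < r \<longrightarrow> X t x \<notin> S (snd p)" by blast
  have "X t x \<notin> S j" if "i \<in> {1..k}" "j \<in> {1..k}" "x \<in> S i" "0 < t" "t < r" for i j x t
    using bspec[OF no_return, of "(i, j)"] that by simp
  then have r: "0 < r" "\<And>x t. x \<in> ?SS \<Longrightarrow> 0 < t \<Longrightarrow> t < r \<Longrightarrow> X t x \<notin> ?SS"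
    using r_pos by blast+
  let ?R = "{r. r > 0 \<and> (\<forall>x\<in>?SS. flow_image X {0<..<r} {x} \<inter> ?SS = {})}"
  have "r \<in> ?R" using r unfolding flow_image_def by auto
  \<comment> \<open>A supremum of reals dominates its set only if the set is bounded. Starting the
    search at time 1 makes the hitting time positive.\<close>
  moreover have "bdd_above ?R"
  proof (rule bdd_aboveI)
    fix u assume u: "u \<in> ?R"
    have hitsS: "\<exists>t\<in>{0..\<epsilon>}. X t q \<in> ?SS" for q
      using hitsT[of q] good(3) by blast
    obtain x where x: "x \<in> ?SS" using hitsS by blast
    obtain t where t: "t \<in> {0..\<epsilon>}" "X t (X 1 x) \<in> ?SS" using hitsS by blast
    show "u \<le> 1 + \<epsilon>"
    proof (rule ccontr)
      assume "\<not> u \<le> 1 + \<epsilon>"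
      then have "t + 1 \<in> {0<..<u}" using t by auto
      then have "X (t + 1) x \<in> flow_image X {0<..<u} {x}" unfolding flow_image_def by blast
      moreover have "X (t + 1) x \<in> ?SS" using t(2) by (simp only: flow_flow)
      ultimately show False using u x by blast
    qed
  qed
  ultimately have "r \<le> theta X k S"
    unfolding theta_def by (intro cSup_upper) auto
  then have \<theta>: "0 < theta X k S" using r(1) by simp
  define \<rho> where "\<rho> = min (\<epsilon> / 6) (theta X k S / 3)"
  have "rho_ok X \<epsilon> k S \<rho>" unfolding rho_ok_def using \<epsilon> \<theta> by (auto simp: \<rho>_def min_def)
  then have "section_system X \<epsilon> (diameter (UNIV :: 'a set) + 1) k S T \<rho>"
    using \<epsilon> adequate by unfold_locales
  then show ?thesis using reg by (rule that)
qed

end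

theorem theorem4:
  fixes X :: "real \<Rightarrow> 'a::metric_space \<Rightarrow> 'a" and N :: nat
  assumes "compact (UNIV :: 'a set)"
    and "is_flow X"
    and "\<forall>x. \<not> fixed_point X x"
    and "0 < N"
  shows "N_expansive X N \<longleftrightarrow>
    (\<forall>\<epsilon> \<delta> k S T \<rho> \<epsilon>0.
       0 < \<epsilon> \<and> 0 < \<delta> \<and> adequate_pair X \<epsilon> \<delta> k S T \<and> rho_ok X \<epsilon> k S \<rho> \<and> eps0_ok X \<delta> k S T \<rho> \<epsilon>0 \<longrightarrow>
       (\<exists>\<eta>. 0 < \<eta> \<and> \<eta> < \<epsilon>0 \<and>
          (\<forall>i\<in>{1..k}. \<forall>x\<in>T i.
             finite (stable_set X k S T \<rho> \<epsilon>0 \<eta> i x \<inter> unstable_set X k S T \<rho> \<epsilon>0 \<eta> i x) \<and>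
             card (stable_set X k S T \<rho> \<epsilon>0 \<eta> i x \<inter> unstable_set X k S T \<rho> \<epsilon>0 \<eta> i x) \<le> N)))"
    (is "_ \<longleftrightarrow> (\<forall>\<epsilon> \<delta> k S T \<rho> \<epsilon>0. ?admissible \<epsilon> \<delta> k S T \<rho> \<epsilon>0 \<longrightarrow> ?bound k S T \<rho> \<epsilon>0)")
proof
  interpret compact_flow X using assms by unfold_locales
  show "\<forall>\<epsilon> \<delta> k S T \<rho> \<epsilon>0. ?admissible \<epsilon> \<delta> k S T \<rho> \<epsilon>0 \<longrightarrow> ?bound k S T \<rho> \<epsilon>0" if "N_expansive X N"
  proof (intro allI impI)
    fix \<epsilon> \<delta> k S T \<rho> \<epsilon>0
    assume *: "?admissible \<epsilon> \<delta> k S T \<rho> \<epsilon>0"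
    interpret section_system X \<epsilon> \<delta> k S T \<rho> using * by unfold_locales auto
    show "?bound k S T \<rho> \<epsilon>0"
      using N_expansive_imp_card_le[OF that, of \<epsilon>0] * unfolding eps0_ok_def by blast
  qed
  assume bounds: "\<forall>\<epsilon> \<delta> k S T \<rho> \<epsilon>0. ?admissible \<epsilon> \<delta> k S T \<rho> \<epsilon>0 \<longrightarrow> ?bound k S T \<rho> \<epsilon>0"
  let ?\<delta> = "diameter (UNIV :: 'a set) + 1"
  obtain \<epsilon> k S T \<rho> where sys: "section_system X \<epsilon> ?\<delta> k S T \<rho>"
    and regular: "\<And>\<kappa> i. 0 < \<kappa> \<Longrightarrow> i \<in> {1..k} \<Longrightarrow> T i \<subseteq> interior (Dset X \<kappa> (S i))"
    using adequate_pair_exists[OF assms(3)] by metis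
  interpret section_system X \<epsilon> ?\<delta> k S T \<rho> by (rule sys)
  obtain \<epsilon>0 where eps0: "eps0_ok X ?\<delta> k S T \<rho> \<epsilon>0"
    using eps0_exists[OF regular[OF rho_pos]] by blast
  have "0 < ?\<delta>" using diameter_ge_0[of "UNIV :: 'a set"] by simp
  then have "?bound k S T \<rho> \<epsilon>0" using bounds eps_pos adequate rho eps0 by blast
  then obtain \<eta> where \<eta>: "0 < \<eta>" "\<eta> < \<epsilon>0"
    "\<forall>i\<in>{1..k}. \<forall>x\<in>T i. finite (W \<epsilon>0 \<eta> i x) \<and> card (W \<epsilon>0 \<eta> i x) \<le> N" by blast
  show "N_expansive X N"
    by (rule card_le_imp_N_expansive[OF regular \<eta>(1,2)]) (use \<eta>(3) in auto)
qed

end
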